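(* Let $X$ be an infinite, compact metric space and let $0<\alpha\le\frac12$. Then the Lipschitz algebra $\operatorname{lip}_\alpha(X)$ is not boundedly approximately contractible.
   Context: For a compact metric space $(X,d)$, $\operatorname{lip}_\alpha(X)$ is the (little) Lipschitz algebra of functions $f:X\to\mathbb C$ with $\sup_{x\ne y}|f(x)-f(y)|/d(x,y)^\alpha<\infty$ and $|f(x)-f(y)|/d(x,y)^\alpha\to0$ as $d(x,y)\to0$, with pointwise multiplication and norm $\|f\|=\|f\|_\infty+\sup_{x\neq y}|f(x)-f(y)|/d(x,y)^\alpha$. A Banach algebra $A$ is boundedly approximately contractible if for every Banach $A$-bimodule $Y$ and every continuous derivation $D:A\to Y$ there is a net $(D_i)$ of inner derivations $A\to Y$, bounded in operator norm, with $D_i(a)\to D(a)$ in norm for all $a\in A$. *)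

theory Defs
  imports "HOL-Analysis.Analysis" "HOL-Algebra.Module"
begin

section \<open>Complex Banach spaces, algebras and bimodules on carrier sets\<close>

text \<open>
  Banach spaces are modules over the field of complex numbers in the sense of
  \<^theory>\<open>HOL-Algebra.Module\<close>, with a norm. The fields \<^const>\<open>mult\<close> and \<^const>\<open>one\<close> inherited
  from the ring record carry no information for a mere Banach space; for a Banach algebra
  \<^const>\<open>mult\<close> is the product, and \<^const>\<open>one\<close> is never referred to, as Banach algebras need not
  be unital.
\<close>

definition complex_field :: "complex ring" where
  "complex_field = \<lparr>carrier = UNIV, mult = (*), one = 1, zero = 0, add = (+)\<rparr>"

record 'a normed_module = "(complex, 'a) module" +
  nrm :: "'a \<Rightarrow> real"

text \<open>
  The value 0 off the carrier is needed because \<^locale>\<open>Metric_space\<close> requires nonnegativity and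
  symmetry for all arguments.
\<close>

definition nrm_dist :: "('a, 'b) normed_module_scheme \<Rightarrow> 'a \<Rightarrow> 'a \<Rightarrow> real" where
  "nrm_dist V x y = (if x \<in> carrier V \<and> y \<in> carrier V then nrm V (x \<ominus>\<^bsub>V\<^esub> y) else 0)"

definition nrm_topology :: "('a, 'b) normed_module_scheme \<Rightarrow> 'a topology" where
  "nrm_topology V = Metric_space.mtopology (carrier V) (nrm_dist V)"

locale complex_normed_space = module complex_field V for V (structure) +
  assumes nrm_eq_0D: "x \<in> carrier V \<Longrightarrow> nrm V x = 0 \<Longrightarrow> x = \<zero>"
    and nrm_smult: "x \<in> carrier V \<Longrightarrow> nrm V (c \<odot> x) = cmod c * nrm V x"
    and nrm_add: "x \<in> carrier V \<Longrightarrow> y \<in> carrier V \<Longrightarrow> nrm V (x \<oplus> y) \<le> nrm V x + nrm V y"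

locale complex_banach_space = complex_normed_space +
  assumes complete: "Metric_space.mcomplete (carrier V) (nrm_dist V)"

locale complex_banach_algebra = complex_banach_space A for A (structure) +
  assumes mult_closed: "a \<in> carrier A \<Longrightarrow> b \<in> carrier A \<Longrightarrow> a \<otimes> b \<in> carrier A"
    and mult_assoc: "a \<in> carrier A \<Longrightarrow> b \<in> carrier A \<Longrightarrow> c \<in> carrier A \<Longrightarrow>
          (a \<otimes> b) \<otimes> c = a \<otimes> (b \<otimes> c)"
    and mult_add_left: "a \<in> carrier A \<Longrightarrow> b \<in> carrier A \<Longrightarrow> c \<in> carrier A \<Longrightarrow>
          (a \<oplus> b) \<otimes> c = (a \<otimes> c) \<oplus> (b \<otimes> c)"
    and mult_add_right: "a \<in> carrier A \<Longrightarrow> b \<in> carrier A \<Longrightarrow> c \<in> carrier A \<Longrightarrow>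
          a \<otimes> (b \<oplus> c) = (a \<otimes> b) \<oplus> (a \<otimes> c)"
    and mult_smult_left: "a \<in> carrier A \<Longrightarrow> b \<in> carrier A \<Longrightarrow> (t \<odot> a) \<otimes> b = t \<odot> (a \<otimes> b)"
    and mult_smult_right: "a \<in> carrier A \<Longrightarrow> b \<in> carrier A \<Longrightarrow> a \<otimes> (t \<odot> b) = t \<odot> (a \<otimes> b)"
    and nrm_mult: "a \<in> carrier A \<Longrightarrow> b \<in> carrier A \<Longrightarrow> nrm A (a \<otimes> b) \<le> nrm A a * nrm A b"

text \<open>
  \<open>l a y\<close> is the left action \<open>a \<cdot> y\<close>, and \<open>r y a\<close> is the right action \<open>y \<cdot> a\<close>.
\<close>

locale banach_bimodule = A: complex_banach_algebra A + Y: complex_banach_space Y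
  for A :: "('a, 'c) normed_module_scheme" (structure)
    and Y :: "('y, 'd) normed_module_scheme" (structure)
    and l :: "'a \<Rightarrow> 'y \<Rightarrow> 'y" and r :: "'y \<Rightarrow> 'a \<Rightarrow> 'y" +
  assumes l_closed: "a \<in> carrier A \<Longrightarrow> y \<in> carrier Y \<Longrightarrow> l a y \<in> carrier Y"
    and l_add_left: "a \<in> carrier A \<Longrightarrow> b \<in> carrier A \<Longrightarrow> y \<in> carrier Y \<Longrightarrow>
          l (a \<oplus>\<^bsub>A\<^esub> b) y = l a y \<oplus>\<^bsub>Y\<^esub> l b y"
    and l_add_right: "a \<in> carrier A \<Longrightarrow> y \<in> carrier Y \<Longrightarrow> z \<in> carrier Y \<Longrightarrow>
          l a (y \<oplus>\<^bsub>Y\<^esub> z) = l a y \<oplus>\<^bsub>Y\<^esub> l a z"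
    and l_smult_left: "a \<in> carrier A \<Longrightarrow> y \<in> carrier Y \<Longrightarrow> l (t \<odot>\<^bsub>A\<^esub> a) y = t \<odot>\<^bsub>Y\<^esub> l a y"
    and l_smult_right: "a \<in> carrier A \<Longrightarrow> y \<in> carrier Y \<Longrightarrow> l a (t \<odot>\<^bsub>Y\<^esub> y) = t \<odot>\<^bsub>Y\<^esub> l a y"
    and r_closed: "a \<in> carrier A \<Longrightarrow> y \<in> carrier Y \<Longrightarrow> r y a \<in> carrier Y"
    and r_add_right: "a \<in> carrier A \<Longrightarrow> b \<in> carrier A \<Longrightarrow> y \<in> carrier Y \<Longrightarrow>
          r y (a \<oplus>\<^bsub>A\<^esub> b) = r y a \<oplus>\<^bsub>Y\<^esub> r y b"
    and r_add_left: "a \<in> carrier A \<Longrightarrow> y \<in> carrier Y \<Longrightarrow> z \<in> carrier Y \<Longrightarrow>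
          r (y \<oplus>\<^bsub>Y\<^esub> z) a = r y a \<oplus>\<^bsub>Y\<^esub> r z a"
    and r_smult_right: "a \<in> carrier A \<Longrightarrow> y \<in> carrier Y \<Longrightarrow> r y (t \<odot>\<^bsub>A\<^esub> a) = t \<odot>\<^bsub>Y\<^esub> r y a"
    and r_smult_left: "a \<in> carrier A \<Longrightarrow> y \<in> carrier Y \<Longrightarrow> r (t \<odot>\<^bsub>Y\<^esub> y) a = t \<odot>\<^bsub>Y\<^esub> r y a"
    and l_assoc: "a \<in> carrier A \<Longrightarrow> b \<in> carrier A \<Longrightarrow> y \<in> carrier Y \<Longrightarrow>
          l (a \<otimes>\<^bsub>A\<^esub> b) y = l a (l b y)"
    and r_assoc: "a \<in> carrier A \<Longrightarrow> b \<in> carrier A \<Longrightarrow> y \<in> carrier Y \<Longrightarrow>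
          r y (a \<otimes>\<^bsub>A\<^esub> b) = r (r y a) b"
    and l_r_assoc: "a \<in> carrier A \<Longrightarrow> b \<in> carrier A \<Longrightarrow> y \<in> carrier Y \<Longrightarrow>
          r (l a y) b = l a (r y b)"
    and l_bounded: "\<exists>K. \<forall>a\<in>carrier A. \<forall>y\<in>carrier Y. nrm Y (l a y) \<le> K * nrm A a * nrm Y y"
    and r_bounded: "\<exists>K. \<forall>a\<in>carrier A. \<forall>y\<in>carrier Y. nrm Y (r y a) \<le> K * nrm A a * nrm Y y"


section \<open>Bounded approximate contractibility\<close>

definition linear_map ::
  "('a, 'c) normed_module_scheme \<Rightarrow> ('y, 'd) normed_module_scheme \<Rightarrow> ('a \<Rightarrow> 'y) \<Rightarrow> bool" where
  "linear_map A Y T \<longleftrightarrow> T \<in> carrier A \<rightarrow> carrier Y \<and>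
     (\<forall>a\<in>carrier A. \<forall>b\<in>carrier A. T (a \<oplus>\<^bsub>A\<^esub> b) = T a \<oplus>\<^bsub>Y\<^esub> T b) \<and>
     (\<forall>t. \<forall>a\<in>carrier A. T (t \<odot>\<^bsub>A\<^esub> a) = t \<odot>\<^bsub>Y\<^esub> T a)"

definition continuous_derivation ::
  "('a, 'c) normed_module_scheme \<Rightarrow> ('y, 'd) normed_module_scheme \<Rightarrow>
   ('a \<Rightarrow> 'y \<Rightarrow> 'y) \<Rightarrow> ('y \<Rightarrow> 'a \<Rightarrow> 'y) \<Rightarrow> ('a \<Rightarrow> 'y) \<Rightarrow> bool" where
  "continuous_derivation A Y l r D \<longleftrightarrow> linear_map A Y D \<and>
     (\<forall>a\<in>carrier A. \<forall>b\<in>carrier A. D (a \<otimes>\<^bsub>A\<^esub> b) = l a (D b) \<oplus>\<^bsub>Y\<^esub> r (D a) b) \<and>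
     continuous_map (nrm_topology A) (nrm_topology Y) D"

definition inner_derivation ::
  "('a, 'c) normed_module_scheme \<Rightarrow> ('y, 'd) normed_module_scheme \<Rightarrow>
   ('a \<Rightarrow> 'y \<Rightarrow> 'y) \<Rightarrow> ('y \<Rightarrow> 'a \<Rightarrow> 'y) \<Rightarrow> ('a \<Rightarrow> 'y) \<Rightarrow> bool" where
  "inner_derivation A Y l r T \<longleftrightarrow>
     (\<exists>y\<in>carrier Y. \<forall>a\<in>carrier A. T a = l a y \<ominus>\<^bsub>Y\<^esub> r y a)"

text \<open>
  A net of inner derivations is represented by a proper filter on the maps from \<open>A\<close> to \<open>Y\<close>
  (for a net, the filter generated by its tails). The lemmas
  \<open>boundedly_approximately_inner_if_net\<close> and \<open>net_if_boundedly_approximately_inner\<close>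
  below give the translation from and to nets over directed index sets.
\<close>

definition boundedly_approximately_inner ::
  "('a, 'c) normed_module_scheme \<Rightarrow> ('y, 'd) normed_module_scheme \<Rightarrow>
   ('a \<Rightarrow> 'y \<Rightarrow> 'y) \<Rightarrow> ('y \<Rightarrow> 'a \<Rightarrow> 'y) \<Rightarrow> ('a \<Rightarrow> 'y) \<Rightarrow> bool" where
  "boundedly_approximately_inner A Y l r D \<longleftrightarrow>
     (\<exists>F. F \<noteq> bot \<and>
        (\<exists>M. \<forall>\<^sub>F T in F. inner_derivation A Y l r T \<and>
              (\<forall>a\<in>carrier A. nrm Y (T a) \<le> M * nrm A a)) \<and>
        (\<forall>a\<in>carrier A. ((\<lambda>T. nrm Y (T a \<ominus>\<^bsub>Y\<^esub> D a)) \<longlongrightarrow> 0) F))"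

definition boundedly_approximately_contractible_on ::
  "'y itself \<Rightarrow> ('a, 'c) normed_module_scheme \<Rightarrow> bool" where
  "boundedly_approximately_contractible_on _ A \<longleftrightarrow>
     (\<forall>(Y :: 'y normed_module) l r D. banach_bimodule A Y l r \<longrightarrow>
        continuous_derivation A Y l r D \<longrightarrow> boundedly_approximately_inner A Y l r D)"

text \<open>
  A definition cannot quantify over the type of the elements of the bimodule. The type
  \<^typ>\<open>nat \<Rightarrow> 'a list\<close> is large enough for the quantification over all Banach bimodules:
  the closed sub-bimodule generated by the range of a derivation consists of limits of sequences
  of finite expressions in elements of \<open>A\<close>, so it has a copy on this type. Theorem
  \<open>boundedly_approximately_contractible_universal\<close> below shows that the property then holds for
  bimodules on every type.
\<close>

definition boundedly_approximately_contractible :: "('a, 'c) normed_module_scheme \<Rightarrow> bool" where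
  "boundedly_approximately_contractible A \<longleftrightarrow>
     boundedly_approximately_contractible_on TYPE(nat \<Rightarrow> 'a list) A"


section \<open>Little Lipschitz algebras\<close>

definition lip_quotients :: "real \<Rightarrow> 'x::metric_space set \<Rightarrow> ('x \<Rightarrow> complex) \<Rightarrow> real set" where
  "lip_quotients \<alpha> X f =
     {cmod (f x - f y) / dist x y powr \<alpha> | x y. x \<in> X \<and> y \<in> X \<and> x \<noteq> y}"

text \<open>
  Functions on \<open>X\<close> are total functions that are \<^const>\<open>undefined\<close> outside \<open>X\<close>.
\<close>

definition lip_functions :: "real \<Rightarrow> 'x::metric_space set \<Rightarrow> ('x \<Rightarrow> complex) set" where
  "lip_functions \<alpha> X =
     {f \<in> extensional X. bdd_above (lip_quotients \<alpha> X f) \<and>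
        (\<forall>\<epsilon>>0. \<exists>\<delta>>0. \<forall>x\<in>X. \<forall>y\<in>X. 0 < dist x y \<longrightarrow> dist x y < \<delta> \<longrightarrow>
            cmod (f x - f y) / dist x y powr \<alpha> < \<epsilon>)}"

text \<open>
  The suprema in the norm are over nonempty sets if \<open>X\<close> has at least two points.
\<close>

definition lip_algebra :: "real \<Rightarrow> 'x::metric_space set \<Rightarrow> ('x \<Rightarrow> complex) normed_module" where
  "lip_algebra \<alpha> X =
     \<lparr>carrier = lip_functions \<alpha> X,
      mult = (\<lambda>f g. \<lambda>x\<in>X. f x * g x),
      one = (\<lambda>x\<in>X. 1),
      zero = (\<lambda>x\<in>X. 0),
      add = (\<lambda>f g. \<lambda>x\<in>X. f x + g x),
      smult = (\<lambda>c f. \<lambda>x\<in>X. c * f x),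
      nrm = (\<lambda>f. (SUP x\<in>X. cmod (f x)) + Sup (lip_quotients \<alpha> X f))\<rparr>"

section \<open>Normed spaces: basic facts\<close>

lemma complex_field_simps [simp]:
  "carrier complex_field = UNIV" "\<one>\<^bsub>complex_field\<^esub> = 1" "\<zero>\<^bsub>complex_field\<^esub> = 0"
  "a \<otimes>\<^bsub>complex_field\<^esub> b = a * b" "a \<oplus>\<^bsub>complex_field\<^esub> b = a + b"
  by (simp_all add: complex_field_def)

lemma cring_complex_field: "cring complex_field"
proof (rule cringI)
  show "abelian_group complex_field"
    by (rule abelian_groupI) (auto intro: exI[of _ "- x" for x] simp: add_eq_0_iff2)
  show "Group.comm_monoid complex_field"
    by (rule comm_monoidI) auto
qed (auto simp: algebra_simps)

lemma complex_field_uminus [simp]: "\<ominus>\<^bsub>complex_field\<^esub> a = - a"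
proof -
  interpret cring complex_field by (rule cring_complex_field)
  show ?thesis using minus_equality[of "-a" a] by simp
qed

context complex_normed_space
begin

lemma smult_closed' [simp, intro]: "x \<in> carrier V \<Longrightarrow> c \<odot> x \<in> carrier V"
  by simp

lemma nrm_zero [simp]: "nrm V \<zero> = 0"
  using nrm_smult[of "\<zero>" 0] smult_l_null[of "\<zero>"] by simp

lemma uminus_smult: "x \<in> carrier V \<Longrightarrow> \<ominus> x = (-1) \<odot> x"
  using smult_l_minus[of 1 x] smult_one[of x] by simp

lemma nrm_uminus: "x \<in> carrier V \<Longrightarrow> nrm V (\<ominus> x) = nrm V x"
  by (simp add: uminus_smult nrm_smult)

lemma nrm_nonneg: "x \<in> carrier V \<Longrightarrow> 0 \<le> nrm V x"
  using nrm_add[of x "\<ominus> x"] by (simp add: nrm_uminus M.r_neg)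

lemma minus_minus_commute:
  assumes "x \<in> carrier V" "y \<in> carrier V" shows "\<ominus> (x \<ominus> y) = y \<ominus> x"
  using assms by (simp add: a_minus_def M.minus_add M.a_comm)

lemma nrm_minus_commute:
  assumes "x \<in> carrier V" "y \<in> carrier V" shows "nrm V (x \<ominus> y) = nrm V (y \<ominus> x)"
  using assms minus_minus_commute nrm_uminus by (metis M.minus_closed)

lemma minus_add_cancel:
  assumes "x \<in> carrier V" "y \<in> carrier V" "z \<in> carrier V"
  shows "(x \<ominus> y) \<oplus> (y \<ominus> z) = x \<ominus> z"
proof -
  have "(\<ominus> y) \<oplus> (y \<oplus> \<ominus> z) = \<ominus> z"
    using assms by (simp add: M.a_assoc[symmetric] M.l_neg)
  then show ?thesis using assms by (simp add: a_minus_def M.a_assoc)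
qed

lemma nrm_triangle:
  assumes "x \<in> carrier V" "y \<in> carrier V" "z \<in> carrier V"
  shows "nrm V (x \<ominus> z) \<le> nrm V (x \<ominus> y) + nrm V (y \<ominus> z)"
  using nrm_add[of "x \<ominus> y" "y \<ominus> z"] minus_add_cancel assms by simp

lemma minus_eq_zeroD:
  assumes "x \<in> carrier V" "y \<in> carrier V" "x \<ominus> y = \<zero>" shows "x = y"
  using M.minus_equality[of x "\<ominus> y"] assms by (simp add: a_minus_def)

lemma minus_self: "x \<in> carrier V \<Longrightarrow> x \<ominus> x = \<zero>"
  by (simp add: a_minus_def M.r_neg)

lemma Metric_space_nrm: "Metric_space (carrier V) (nrm_dist V)"
proof
  fix x y z
  show "0 \<le> nrm_dist V x y" by (simp add: nrm_dist_def nrm_nonneg)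
  show "nrm_dist V x y = nrm_dist V y x" by (simp add: nrm_dist_def nrm_minus_commute)
  show "(nrm_dist V x y = 0) = (x = y)" if xy: "x \<in> carrier V" "y \<in> carrier V"
  proof
    assume "nrm_dist V x y = 0"
    then have "nrm V (x \<ominus> y) = 0" using xy unfolding nrm_dist_def by presburger
    then show "x = y" using minus_eq_zeroD nrm_eq_0D xy M.minus_closed by blast
  next
    assume "x = y"
    then show "nrm_dist V x y = 0" using xy minus_self[of y] by (simp add: nrm_dist_def)
  qed
  show "nrm_dist V x z \<le> nrm_dist V x y + nrm_dist V y z"
    if "x \<in> carrier V" "y \<in> carrier V" "z \<in> carrier V"
    using that nrm_triangle[OF that] unfolding nrm_dist_def by presburger
qed

lemma mcomplete_nrm_iff:
  "Metric_space.mcomplete (carrier V) (nrm_dist V) \<longleftrightarrow>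
    (\<forall>s :: nat \<Rightarrow> 'a. (\<forall>n. s n \<in> carrier V) \<longrightarrow>
       (\<forall>e>0. \<exists>N. \<forall>m\<ge>N. \<forall>n\<ge>N. nrm V (s m \<ominus> s n) < e) \<longrightarrow>
       (\<exists>x\<in>carrier V. \<forall>e>0. \<exists>N. \<forall>n\<ge>N. nrm V (s n \<ominus> x) < e))"
proof -
  interpret Metric_space "carrier V" "nrm_dist V" by (rule Metric_space_nrm)
  have C: "MCauchy s \<longleftrightarrow> (\<forall>n. s n \<in> carrier V) \<and>
       (\<forall>e>0. \<exists>N. \<forall>m\<ge>N. \<forall>n\<ge>N. nrm V (s m \<ominus> s n) < e)" for s
  proof (cases "\<forall>n. s n \<in> carrier V")
    case True
    have "(\<forall>n n'. N \<le> n \<longrightarrow> N \<le> n' \<longrightarrow> nrm V (s n \<ominus> s n') < e) \<longleftrightarrow>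
        (\<forall>m\<ge>N. \<forall>n\<ge>N. nrm V (s m \<ominus> s n) < e)" for N e
      by blast
    with True show ?thesis
      unfolding MCauchy_def nrm_dist_def image_subset_iff by simp
  next
    case False
    then show ?thesis unfolding MCauchy_def by auto
  qed
  have L: "(\<exists>x. limitin mtopology s x sequentially) \<longleftrightarrow>
       (\<exists>x\<in>carrier V. \<forall>e>0. \<exists>N. \<forall>n\<ge>N. nrm V (s n \<ominus> x) < e)" if "\<forall>n. s n \<in> carrier V" for s
    unfolding limit_metric_sequentially nrm_dist_def Bex_def using that
    by (intro iff_exI conj_cong refl) simp
  show ?thesis unfolding mcomplete_def C
    by (rule iff_allI) (use L in auto)
qed

end

lemma continuous_map_nrm_iff:
  assumes "complex_normed_space V" "complex_normed_space W"
  shows "continuous_map (nrm_topology V) (nrm_topology W) f \<longleftrightarrow> f \<in> carrier V \<rightarrow> carrier W \<and>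
    (\<forall>a\<in>carrier V. \<forall>e>0. \<exists>d>0. \<forall>x\<in>carrier V. nrm V (a \<ominus>\<^bsub>V\<^esub> x) < d \<longrightarrow> nrm W (f a \<ominus>\<^bsub>W\<^esub> f x) < e)"
proof -
  interpret Metric_space "carrier V" "nrm_dist V" by (rule complex_normed_space.Metric_space_nrm[OF assms(1)])
  have *: "f ` carrier V \<subseteq> carrier W \<and>
      (\<forall>a\<in>carrier V. \<forall>e>0. \<exists>d>0. \<forall>x. x \<in> carrier V \<and> nrm_dist V a x < d \<longrightarrow> nrm_dist W (f a) (f x) < e) \<longleftrightarrow>
      f ` carrier V \<subseteq> carrier W \<and>
      (\<forall>a\<in>carrier V. \<forall>e>0. \<exists>d>0. \<forall>x\<in>carrier V. nrm V (a \<ominus>\<^bsub>V\<^esub> x) < d \<longrightarrow> nrm W (f a \<ominus>\<^bsub>W\<^esub> f x) < e)"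
    unfolding nrm_dist_def image_subset_iff
    by (intro conj_cong refl ball_cong all_cong iff_exI) (simp_all add: Ball_def imp_conjL)
  show ?thesis
    unfolding nrm_topology_def
      metric_continuous_map[OF complex_normed_space.Metric_space_nrm[OF assms(2)]] *
    by (simp add: image_subset_iff_funcset)
qed

section \<open>The choice of the type of the bimodule is immaterial\<close>

definition transported :: "('y \<Rightarrow> 'z) \<Rightarrow> 'y set \<Rightarrow> ('y, 'd) normed_module_scheme \<Rightarrow> 'z normed_module" where
  "transported j S Y =
     \<lparr>carrier = j ` S, mult = (\<lambda>_ _. j \<zero>\<^bsub>Y\<^esub>), one = j \<zero>\<^bsub>Y\<^esub>, zero = j \<zero>\<^bsub>Y\<^esub>,
      add = (\<lambda>x y. j (inv_into S j x \<oplus>\<^bsub>Y\<^esub> inv_into S j y)),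
      smult = (\<lambda>c x. j (c \<odot>\<^bsub>Y\<^esub> inv_into S j x)),
      nrm = (\<lambda>x. nrm Y (inv_into S j x))\<rparr>"

locale transported_bimodule = banach_bimodule A Y l r
  for A :: "('a, 'c) normed_module_scheme" (structure)
    and Y :: "('y, 'd) normed_module_scheme" (structure)
    and l :: "'a \<Rightarrow> 'y \<Rightarrow> 'y" and r :: "'y \<Rightarrow> 'a \<Rightarrow> 'y" +
  fixes S :: "'y set" and j :: "'y \<Rightarrow> 'z"
  assumes S_sub: "S \<subseteq> carrier Y"
    and S_zero: "\<zero>\<^bsub>Y\<^esub> \<in> S"
    and S_add: "x \<in> S \<Longrightarrow> y \<in> S \<Longrightarrow> x \<oplus>\<^bsub>Y\<^esub> y \<in> S"
    and S_smult: "x \<in> S \<Longrightarrow> c \<odot>\<^bsub>Y\<^esub> x \<in> S"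
    and S_l: "a \<in> carrier A \<Longrightarrow> x \<in> S \<Longrightarrow> l a x \<in> S"
    and S_r: "a \<in> carrier A \<Longrightarrow> x \<in> S \<Longrightarrow> r x a \<in> S"
    and S_closed: "y \<in> carrier Y \<Longrightarrow> (\<And>e. e > 0 \<Longrightarrow> \<exists>x\<in>S. nrm Y (y \<ominus>\<^bsub>Y\<^esub> x) < e) \<Longrightarrow> y \<in> S"
    and inj_j: "inj_on j S"
begin

abbreviation k where "k \<equiv> inv_into S j"
abbreviation Y' where "Y' \<equiv> transported j S Y"
abbreviation l' where "l' \<equiv> \<lambda>a x. j (l a (k x))"
abbreviation r' where "r' \<equiv> \<lambda>x a. j (r (k x) a)"

lemma k_j [simp]: "x \<in> S \<Longrightarrow> k (j x) = x"
  by (simp add: inj_j)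

lemma S_carrier [simp]: "x \<in> S \<Longrightarrow> x \<in> carrier Y"
  using S_sub by blast

lemma transported_simps [simp]:
  "carrier Y' = j ` S" "\<zero>\<^bsub>Y'\<^esub> = j \<zero>\<^bsub>Y\<^esub>" "x \<oplus>\<^bsub>Y'\<^esub> y = j (k x \<oplus>\<^bsub>Y\<^esub> k y)"
  "c \<odot>\<^bsub>Y'\<^esub> x = j (c \<odot>\<^bsub>Y\<^esub> k x)" "nrm Y' x = nrm Y (k x)"
  by (simp_all add: transported_def)

lemma S_uminus: "x \<in> S \<Longrightarrow> \<ominus>\<^bsub>Y\<^esub> x \<in> S"
  by (simp add: Y.uminus_smult S_smult)

lemma S_minus: "x \<in> S \<Longrightarrow> y \<in> S \<Longrightarrow> x \<ominus>\<^bsub>Y\<^esub> y \<in> S"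
  by (simp add: a_minus_def S_uminus S_add)

lemma abelian_group_transported: "abelian_group Y'"
proof (rule abelian_groupI)
  fix x assume "x \<in> carrier Y'"
  then obtain s where s: "s \<in> S" "x = j s" by auto
  then show "\<exists>y\<in>carrier Y'. y \<oplus>\<^bsub>Y'\<^esub> x = \<zero>\<^bsub>Y'\<^esub>"
    by (intro bexI[of _ "j (\<ominus>\<^bsub>Y\<^esub> s)"]) (auto simp: S_uminus Y.M.l_neg)
qed (auto simp: S_zero S_add Y.M.a_assoc Y.M.a_comm Y.M.a_lcomm)

lemma minus_transported:
  assumes "x \<in> S" "y \<in> S" shows "j x \<ominus>\<^bsub>Y'\<^esub> j y = j (x \<ominus>\<^bsub>Y\<^esub> y)"
proof -
  interpret Y': abelian_group Y' by (rule abelian_group_transported)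
  have "\<ominus>\<^bsub>Y'\<^esub> (j y) = j (\<ominus>\<^bsub>Y\<^esub> y)"
    by (rule Y'.minus_equality) (use assms in \<open>auto simp: S_uminus Y.M.l_neg\<close>)
  then show ?thesis using assms by (simp add: a_minus_def S_uminus)
qed

lemma normed_transported: "complex_normed_space Y'"
proof -
  have "module complex_field Y'"
    by (rule moduleI[OF cring_complex_field abelian_group_transported])
      (auto simp: S_smult S_add Y.smult_l_distr[simplified] Y.smult_r_distr Y.smult_assoc1[simplified]
        Y.smult_one[simplified])
  then show ?thesis
    by (intro complex_normed_space.intro complex_normed_space_axioms.intro)
      (auto simp: S_smult S_add Y.nrm_smult Y.nrm_add dest: Y.nrm_eq_0D[OF S_carrier])
qed

lemma banach_transported: "complex_banach_space Y'"
proof -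
  interpret Y': complex_normed_space Y' by (rule normed_transported)
  have "\<exists>x\<in>carrier Y'. \<forall>e>0. \<exists>N. \<forall>n\<ge>N. nrm Y' (s n \<ominus>\<^bsub>Y'\<^esub> x) < e"
    if s: "\<forall>n. s n \<in> carrier Y'" 
      and C: "\<forall>e>0. \<exists>N. \<forall>m\<ge>N. \<forall>n\<ge>N. nrm Y' (s m \<ominus>\<^bsub>Y'\<^esub> s n) < e" for s :: "nat \<Rightarrow> 'z"
  proof -
    from s have "\<forall>n. \<exists>x. x \<in> S \<and> s n = j x" by auto
    then obtain t where t: "\<And>n. t n \<in> S" "\<And>n. s n = j (t n)" by metis
    have "nrm Y' (s m \<ominus>\<^bsub>Y'\<^esub> s n) = nrm Y (t m \<ominus>\<^bsub>Y\<^esub> t n)" for m n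
      by (simp add: t minus_transported S_minus)
    with C have "\<forall>e>0. \<exists>N. \<forall>m\<ge>N. \<forall>n\<ge>N. nrm Y (t m \<ominus>\<^bsub>Y\<^esub> t n) < e" by simp
    then obtain y where y: "y \<in> carrier Y" "\<And>e. e>0 \<Longrightarrow> \<exists>N. \<forall>n\<ge>N. nrm Y (t n \<ominus>\<^bsub>Y\<^esub> y) < e"
      using Y.complete[unfolded Y.mcomplete_nrm_iff, rule_format, of t] t(1) by auto
    have "y \<in> S"
    proof (rule S_closed[OF y(1)])
      fix e :: real assume "e > 0"
      with y(2) obtain N where "nrm Y (t N \<ominus>\<^bsub>Y\<^esub> y) < e" by blast
      then show "\<exists>x\<in>S. nrm Y (y \<ominus>\<^bsub>Y\<^esub> x) < e"
        using t(1)[of N] y(1) Y.nrm_minus_commute[of y "t N"] by (intro bexI[of _ "t N"]) auto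
    qed
    then have "nrm Y' (s n \<ominus>\<^bsub>Y'\<^esub> j y) = nrm Y (t n \<ominus>\<^bsub>Y\<^esub> y)" for n
      by (simp add: t minus_transported S_minus)
    then show ?thesis using y(2) \<open>y \<in> S\<close> by (intro bexI[of _ "j y"]) auto
  qed
  then show ?thesis
    by (intro complex_banach_space.intro normed_transported complex_banach_space_axioms.intro)
      (unfold Y'.mcomplete_nrm_iff, blast)
qed

lemma bimodule_transported: "banach_bimodule A Y' l' r'"
proof -
  obtain K1 where K1: "\<forall>a\<in>carrier A. \<forall>y\<in>carrier Y. nrm Y (l a y) \<le> K1 * nrm A a * nrm Y y"
    using l_bounded by blast
  obtain K2 where K2: "\<forall>a\<in>carrier A. \<forall>y\<in>carrier Y. nrm Y (r y a) \<le> K2 * nrm A a * nrm Y y"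
    using r_bounded by blast
  show ?thesis
  proof (intro banach_bimodule.intro banach_transported A.complex_banach_algebra_axioms
      banach_bimodule_axioms.intro)
    show "\<exists>K. \<forall>a\<in>carrier A. \<forall>y\<in>carrier Y'. nrm Y' (l' a y) \<le> K * nrm A a * nrm Y' y"
      by (rule exI[of _ K1]) (use K1 in \<open>auto simp: S_l\<close>)
    show "\<exists>K. \<forall>a\<in>carrier A. \<forall>y\<in>carrier Y'. nrm Y' (r' y a) \<le> K * nrm A a * nrm Y' y"
      by (rule exI[of _ K2]) (use K2 in \<open>auto simp: S_r\<close>)
  qed (auto simp: S_l S_r S_add S_smult l_add_left l_add_right l_smult_left l_smult_right
        r_add_left r_add_right r_smult_left r_smult_right l_assoc r_assoc l_r_assoc)
qed

lemma continuous_derivation_transported: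
  assumes D: "continuous_derivation A Y l r D" and DS: "\<And>a. a \<in> carrier A \<Longrightarrow> D a \<in> S"
  shows "continuous_derivation A Y' l' r' (\<lambda>a. j (D a))"
proof -
  have AN: "complex_normed_space A" by (rule A.complex_normed_space_axioms)
  have c: "D \<in> carrier A \<rightarrow> carrier Y \<and>
    (\<forall>a\<in>carrier A. \<forall>e>0. \<exists>d>0. \<forall>x\<in>carrier A. nrm A (a \<ominus>\<^bsub>A\<^esub> x) < d \<longrightarrow> nrm Y (D a \<ominus>\<^bsub>Y\<^esub> D x) < e)"
    using D unfolding continuous_derivation_def
      continuous_map_nrm_iff[OF AN Y.complex_normed_space_axioms] by blast
  have eq: "nrm Y' (j (D a) \<ominus>\<^bsub>Y'\<^esub> j (D x)) = nrm Y (D a \<ominus>\<^bsub>Y\<^esub> D x)"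
    if "a \<in> carrier A" "x \<in> carrier A" for a x
    using that by (simp add: minus_transported DS S_minus)
  have "continuous_map (nrm_topology A) (nrm_topology Y') (\<lambda>a. j (D a))"
    unfolding continuous_map_nrm_iff[OF AN normed_transported]
    using c eq by (simp add: DS)
  then show ?thesis
    using D unfolding continuous_derivation_def linear_map_def by (auto simp: DS S_l S_r)
qed

lemma inner_transported:
  assumes "boundedly_approximately_inner A Y' l' r' (\<lambda>a. j (D a))"
    and DS: "\<And>a. a \<in> carrier A \<Longrightarrow> D a \<in> S"
  shows "boundedly_approximately_inner A Y l r D"
proof -
  obtain F M where F: "F \<noteq> bot"
    and ev: "\<forall>\<^sub>F T in F. inner_derivation A Y' l' r' T \<and> (\<forall>a\<in>carrier A. nrm Y' (T a) \<le> M * nrm A a)"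
    and lim: "\<And>a. a \<in> carrier A \<Longrightarrow> ((\<lambda>T. nrm Y' (T a \<ominus>\<^bsub>Y'\<^esub> j (D a))) \<longlongrightarrow> 0) F"
    using assms(1) unfolding boundedly_approximately_inner_def by blast
  have TS: "T a \<in> j ` S" if "inner_derivation A Y' l' r' T" "a \<in> carrier A" for T a
    using that unfolding inner_derivation_def by (auto simp: minus_transported S_l S_r S_minus)
  have in': "inner_derivation A Y l r (\<lambda>a. k (T a))" if "inner_derivation A Y' l' r' T" for T
    using that unfolding inner_derivation_def
    by (auto simp: minus_transported S_l S_r S_minus intro!: bexI)
  let ?G = "filtermap (\<lambda>T a. k (T a)) F"
  have "\<forall>\<^sub>F T in ?G. inner_derivation A Y l r T \<and> (\<forall>a\<in>carrier A. nrm Y (T a) \<le> M * nrm A a)"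
    unfolding eventually_filtermap using ev by (rule eventually_mono) (auto intro: in')
  moreover have "((\<lambda>T. nrm Y (T a \<ominus>\<^bsub>Y\<^esub> D a)) \<longlongrightarrow> 0) ?G" if a: "a \<in> carrier A" for a
    unfolding filterlim_filtermap
  proof (rule Lim_transform_eventually[OF lim[OF a]])
    show "\<forall>\<^sub>F T in F. nrm Y' (T a \<ominus>\<^bsub>Y'\<^esub> j (D a)) = nrm Y (k (T a) \<ominus>\<^bsub>Y\<^esub> D a)"
      using ev
    proof (rule eventually_mono)
      fix T assume "inner_derivation A Y' l' r' T \<and> (\<forall>a\<in>carrier A. nrm Y' (T a) \<le> M * nrm A a)"
      then obtain s where "s \<in> S" "T a = j s" using TS[of T a] a by auto
      then show "nrm Y' (T a \<ominus>\<^bsub>Y'\<^esub> j (D a)) = nrm Y (k (T a) \<ominus>\<^bsub>Y\<^esub> D a)"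
        using DS[OF a] by (simp add: minus_transported S_minus)
    qed
  qed
  ultimately show ?thesis
    unfolding boundedly_approximately_inner_def
    by (intro exI[of _ ?G]) (use F in \<open>auto simp: filtermap_bot_iff\<close>)
qed

end

inductive_set derivation_span ::
  "('a, 'c) normed_module_scheme \<Rightarrow> ('y, 'd) normed_module_scheme \<Rightarrow>
   ('a \<Rightarrow> 'y \<Rightarrow> 'y) \<Rightarrow> ('a \<Rightarrow> 'y) \<Rightarrow> 'y set"
  for A :: "('a, 'c) normed_module_scheme" and Y :: "('y, 'd) normed_module_scheme"
    and l :: "'a \<Rightarrow> 'y \<Rightarrow> 'y" and D :: "'a \<Rightarrow> 'y" where
  base: "c \<in> carrier A \<Longrightarrow> D c \<in> derivation_span A Y l D"
| step: "a \<in> carrier A \<Longrightarrow> b \<in> carrier A \<Longrightarrow> x \<in> derivation_span A Y l D \<Longrightarrow>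
    l a (D b) \<oplus>\<^bsub>Y\<^esub> x \<in> derivation_span A Y l D"

fun span_expr ::
  "('y, 'd) normed_module_scheme \<Rightarrow> ('a \<Rightarrow> 'y \<Rightarrow> 'y) \<Rightarrow> ('a \<Rightarrow> 'y) \<Rightarrow> 'a list \<Rightarrow> 'y" where
  "span_expr Y l D [] = \<zero>\<^bsub>Y\<^esub>"
| "span_expr Y l D [c] = D c"
| "span_expr Y l D (a # b # cs) = l a (D b) \<oplus>\<^bsub>Y\<^esub> span_expr Y l D cs"

lemma derivation_span_subset_exprs: "derivation_span A Y l D \<subseteq> range (span_expr Y l D)"
proof
  fix x assume "x \<in> derivation_span A Y l D"
  then show "x \<in> range (span_expr Y l D)"
  proof induction
    case (base c)
    show ?case by (rule range_eqI[of _ _ "[c]"]) simp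
  next
    case (step a b x)
    then obtain cs where "x = span_expr Y l D cs" by blast
    then show ?case by (intro range_eqI[of _ _ "a # b # cs"]) simp
  qed
qed

context banach_bimodule
begin

lemma l_minus: "a \<in> carrier A \<Longrightarrow> y \<in> carrier Y \<Longrightarrow> z \<in> carrier Y \<Longrightarrow>
    l a (y \<ominus>\<^bsub>Y\<^esub> z) = l a y \<ominus>\<^bsub>Y\<^esub> l a z"
  by (simp add: a_minus_def Y.uminus_smult l_add_right l_smult_right l_closed)

lemma r_minus: "a \<in> carrier A \<Longrightarrow> y \<in> carrier Y \<Longrightarrow> z \<in> carrier Y \<Longrightarrow>
    r (y \<ominus>\<^bsub>Y\<^esub> z) a = r y a \<ominus>\<^bsub>Y\<^esub> r z a"
  by (simp add: a_minus_def Y.uminus_smult r_add_left r_smult_left r_closed)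

context
  fixes D
  assumes D: "continuous_derivation A Y l r D"
begin

private abbreviation G where "G \<equiv> derivation_span A Y l D"

definition closed_span where
  "closed_span = {y \<in> carrier Y. \<forall>e>0. \<exists>x\<in>G. nrm Y (y \<ominus>\<^bsub>Y\<^esub> x) < e}"

lemma D_closed: "a \<in> carrier A \<Longrightarrow> D a \<in> carrier Y"
  and D_add: "a \<in> carrier A \<Longrightarrow> b \<in> carrier A \<Longrightarrow> D (a \<oplus>\<^bsub>A\<^esub> b) = D a \<oplus>\<^bsub>Y\<^esub> D b"
  and D_smult: "a \<in> carrier A \<Longrightarrow> D (t \<odot>\<^bsub>A\<^esub> a) = t \<odot>\<^bsub>Y\<^esub> D a"
  and D_mult: "a \<in> carrier A \<Longrightarrow> b \<in> carrier A \<Longrightarrow>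
    D (a \<otimes>\<^bsub>A\<^esub> b) = l a (D b) \<oplus>\<^bsub>Y\<^esub> r (D a) b"
  using D unfolding continuous_derivation_def linear_map_def by auto

lemma D_zero: "D \<zero>\<^bsub>A\<^esub> = \<zero>\<^bsub>Y\<^esub>"
proof -
  have "D (0 \<odot>\<^bsub>A\<^esub> \<zero>\<^bsub>A\<^esub>) = 0 \<odot>\<^bsub>Y\<^esub> D \<zero>\<^bsub>A\<^esub>" by (rule D_smult) simp
  then show ?thesis
    using A.smult_l_null[of "\<zero>\<^bsub>A\<^esub>"] Y.smult_l_null[of "D \<zero>\<^bsub>A\<^esub>"] D_closed[of "\<zero>\<^bsub>A\<^esub>"] by simp
qed

lemma G_carrier: "x \<in> G \<Longrightarrow> x \<in> carrier Y"
  by (induction rule: derivation_span.induct) (auto simp: D_closed l_closed)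

lemma G_zero: "\<zero>\<^bsub>Y\<^esub> \<in> G"
  using derivation_span.base[of "\<zero>\<^bsub>A\<^esub>" A D Y l] D_zero by simp

lemma G_D_add: "y \<in> G \<Longrightarrow> c \<in> carrier A \<Longrightarrow> D c \<oplus>\<^bsub>Y\<^esub> y \<in> G"
proof (induction rule: derivation_span.induct)
  case (base c')
  then show ?case using derivation_span.base[of "c \<oplus>\<^bsub>A\<^esub> c'" A D Y l] by (simp add: D_add)
next
  case (step a b x)
  have "D c \<oplus>\<^bsub>Y\<^esub> (l a (D b) \<oplus>\<^bsub>Y\<^esub> x) = l a (D b) \<oplus>\<^bsub>Y\<^esub> (D c \<oplus>\<^bsub>Y\<^esub> x)"
    using step by (simp add: Y.M.a_lcomm D_closed l_closed G_carrier)
  with step show ?case by (simp add: derivation_span.step)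
qed

lemma G_add: "x \<in> G \<Longrightarrow> y \<in> G \<Longrightarrow> x \<oplus>\<^bsub>Y\<^esub> y \<in> G"
proof (induction rule: derivation_span.induct)
  case (base c)
  then show ?case by (simp add: G_D_add)
next
  case (step a b x)
  have "(l a (D b) \<oplus>\<^bsub>Y\<^esub> x) \<oplus>\<^bsub>Y\<^esub> y = l a (D b) \<oplus>\<^bsub>Y\<^esub> (x \<oplus>\<^bsub>Y\<^esub> y)"
    using step by (simp add: Y.M.a_assoc D_closed l_closed G_carrier)
  with step show ?case by (simp add: derivation_span.step)
qed

lemma G_l_D: "a \<in> carrier A \<Longrightarrow> b \<in> carrier A \<Longrightarrow> l a (D b) \<in> G"
  using derivation_span.step[OF _ _ G_zero, of a b] by (simp add: D_closed l_closed)

lemma G_smult: "x \<in> G \<Longrightarrow> t \<odot>\<^bsub>Y\<^esub> x \<in> G"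
proof (induction rule: derivation_span.induct)
  case (base c)
  then show ?case using derivation_span.base[of "t \<odot>\<^bsub>A\<^esub> c" A D Y l] by (simp add: D_smult)
next
  case (step a b x)
  have "t \<odot>\<^bsub>Y\<^esub> (l a (D b) \<oplus>\<^bsub>Y\<^esub> x) = l (t \<odot>\<^bsub>A\<^esub> a) (D b) \<oplus>\<^bsub>Y\<^esub> (t \<odot>\<^bsub>Y\<^esub> x)"
    using step by (simp add: Y.smult_r_distr l_smult_left D_closed l_closed G_carrier)
  with step show ?case by (simp add: derivation_span.step)
qed

lemma G_l: "x \<in> G \<Longrightarrow> e \<in> carrier A \<Longrightarrow> l e x \<in> G"
proof (induction rule: derivation_span.induct)
  case (base c)
  then show ?case by (simp add: G_l_D)
next
  case (step a b x)
  have "l e (l a (D b) \<oplus>\<^bsub>Y\<^esub> x) = l (e \<otimes>\<^bsub>A\<^esub> a) (D b) \<oplus>\<^bsub>Y\<^esub> l e x"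
    using step by (simp add: l_add_right l_assoc D_closed l_closed G_carrier)
  with step show ?case by (simp add: derivation_span.step A.mult_closed)
qed

lemma G_r_D: "c \<in> carrier A \<Longrightarrow> e \<in> carrier A \<Longrightarrow> r (D c) e \<in> G"
proof -
  assume c: "c \<in> carrier A" and e: "e \<in> carrier A"
  have "(-1) \<odot>\<^bsub>Y\<^esub> l c (D e) \<oplus>\<^bsub>Y\<^esub> D (c \<otimes>\<^bsub>A\<^esub> e) = r (D c) e"
    using c e Y.uminus_smult[of "l c (D e)"]
    by (simp add: D_mult D_closed l_closed r_closed Y.M.a_assoc[symmetric] Y.M.l_neg flip: Y.uminus_smult)
  moreover have "(-1) \<odot>\<^bsub>Y\<^esub> l c (D e) \<oplus>\<^bsub>Y\<^esub> D (c \<otimes>\<^bsub>A\<^esub> e) \<in> G"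
    using c e by (intro G_add G_smult G_l_D derivation_span.base) (auto simp: A.mult_closed)
  ultimately show ?thesis by simp
qed

lemma G_r: "x \<in> G \<Longrightarrow> e \<in> carrier A \<Longrightarrow> r x e \<in> G"
proof (induction rule: derivation_span.induct)
  case (base c)
  then show ?case by (simp add: G_r_D)
next
  case (step a b x)
  have "r (l a (D b) \<oplus>\<^bsub>Y\<^esub> x) e = l a (r (D b) e) \<oplus>\<^bsub>Y\<^esub> r x e"
    using step by (simp add: r_add_left l_r_assoc D_closed l_closed G_carrier)
  with step show ?case by (simp add: G_add G_l G_r_D)
qed

lemma closed_span_map:
  assumes G: "\<And>x. x \<in> G \<Longrightarrow> T x \<in> G" and y: "y \<in> closed_span"
    and T: "\<And>x. x \<in> carrier Y \<Longrightarrow> T x \<in> carrier Y"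
    and lip: "\<And>x. x \<in> carrier Y \<Longrightarrow> nrm Y (T y \<ominus>\<^bsub>Y\<^esub> T x) \<le> K * nrm Y (y \<ominus>\<^bsub>Y\<^esub> x)"
  shows "T y \<in> closed_span"
proof -
  have yY: "y \<in> carrier Y" using y by (simp add: closed_span_def)
  have "\<exists>x\<in>G. nrm Y (T y \<ominus>\<^bsub>Y\<^esub> x) < e" if "e > 0" for e
  proof -
    let ?C = "max K 1"
    have "e / ?C > 0" using that by (simp add: max_def)
    then obtain x where x: "x \<in> G" "nrm Y (y \<ominus>\<^bsub>Y\<^esub> x) < e / ?C"
      using y unfolding closed_span_def by blast
    have "nrm Y (T y \<ominus>\<^bsub>Y\<^esub> T x) \<le> K * nrm Y (y \<ominus>\<^bsub>Y\<^esub> x)" by (rule lip[OF G_carrier[OF x(1)]])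
    also have "\<dots> \<le> ?C * nrm Y (y \<ominus>\<^bsub>Y\<^esub> x)"
      using yY G_carrier[OF x(1)] by (intro mult_right_mono) (auto simp: Y.nrm_nonneg)
    also have "\<dots> < e"
      using x(2) by (simp add: pos_less_divide_eq mult.commute)
    finally show ?thesis using G[OF x(1)] by blast
  qed
  then show ?thesis using T[OF yY] by (simp add: closed_span_def)
qed

lemma closed_span_add:
  assumes "y \<in> closed_span" "z \<in> closed_span"
  shows "y \<oplus>\<^bsub>Y\<^esub> z \<in> closed_span"
proof -
  have Y: "y \<in> carrier Y" "z \<in> carrier Y" using assms by (auto simp: closed_span_def)
  have "\<exists>x\<in>G. nrm Y ((y \<oplus>\<^bsub>Y\<^esub> z) \<ominus>\<^bsub>Y\<^esub> x) < e" if "e > 0" for e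
  proof -
    from that have "e / 2 > 0" by simp
    then obtain u v where u: "u \<in> G" "nrm Y (y \<ominus>\<^bsub>Y\<^esub> u) < e / 2" and v: "v \<in> G" "nrm Y (z \<ominus>\<^bsub>Y\<^esub> v) < e / 2"
      using assms unfolding closed_span_def by blast
    note uv = G_carrier[OF u(1)] G_carrier[OF v(1)]
    have "(y \<oplus>\<^bsub>Y\<^esub> z) \<ominus>\<^bsub>Y\<^esub> (u \<oplus>\<^bsub>Y\<^esub> v) = (y \<ominus>\<^bsub>Y\<^esub> u) \<oplus>\<^bsub>Y\<^esub> (z \<ominus>\<^bsub>Y\<^esub> v)"
      using Y uv by (simp add: a_minus_def Y.M.minus_add Y.M.a_ac)
    then have "nrm Y ((y \<oplus>\<^bsub>Y\<^esub> z) \<ominus>\<^bsub>Y\<^esub> (u \<oplus>\<^bsub>Y\<^esub> v)) < e"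
      using Y.nrm_add[of "y \<ominus>\<^bsub>Y\<^esub> u" "z \<ominus>\<^bsub>Y\<^esub> v"] Y uv u(2) v(2) by simp
    then show ?thesis using G_add[OF u(1) v(1)] by blast
  qed
  then show ?thesis using Y by (simp add: closed_span_def)
qed

lemma G_subset_closed_span: "G \<subseteq> closed_span"
  unfolding closed_span_def by (auto simp: G_carrier Y.minus_self intro!: bexI)

definition span_code :: "'y \<Rightarrow> nat \<Rightarrow> 'a list" where
  "span_code y = (\<lambda>n. SOME cs. span_expr Y l D cs \<in> G \<and>
      nrm Y (y \<ominus>\<^bsub>Y\<^esub> span_expr Y l D cs) < inverse (real (Suc n)))"

lemma span_code:
  assumes "y \<in> closed_span"
  shows "span_expr Y l D (span_code y n) \<in> G"
    "nrm Y (y \<ominus>\<^bsub>Y\<^esub> span_expr Y l D (span_code y n)) < inverse (real (Suc n))"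
proof -
  have pos: "inverse (real (Suc n)) > 0" by simp
  obtain x where x: "x \<in> G" "nrm Y (y \<ominus>\<^bsub>Y\<^esub> x) < inverse (real (Suc n))"
    using assms pos unfolding closed_span_def by blast
  moreover obtain cs where "x = span_expr Y l D cs"
    using subsetD[OF derivation_span_subset_exprs x(1)] by (rule rangeE)
  ultimately have "\<exists>cs. span_expr Y l D cs \<in> G \<and>
      nrm Y (y \<ominus>\<^bsub>Y\<^esub> span_expr Y l D cs) < inverse (real (Suc n))" by blast
  from someI_ex[OF this] show "span_expr Y l D (span_code y n) \<in> G"
    "nrm Y (y \<ominus>\<^bsub>Y\<^esub> span_expr Y l D (span_code y n)) < inverse (real (Suc n))"
    by (auto simp: span_code_def)
qed

lemma inj_on_span_code: "inj_on span_code closed_span"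
proof (rule inj_onI)
  fix y z assume y: "y \<in> closed_span" and z: "z \<in> closed_span" and eq: "span_code y = span_code z"
  have Y: "y \<in> carrier Y" "z \<in> carrier Y" using y z by (auto simp: closed_span_def)
  have *: "nrm Y (y \<ominus>\<^bsub>Y\<^esub> z) < e" if e: "e > 0" for e
  proof -
    obtain n where n: "inverse (real (Suc n)) < e / 2"
      using reals_Archimedean[of "e / 2"] e by auto
    let ?x = "span_expr Y l D (span_code y n)"
    have x: "?x \<in> carrier Y" using span_code(1)[OF y] by (rule G_carrier)
    have "nrm Y (y \<ominus>\<^bsub>Y\<^esub> z) \<le> nrm Y (y \<ominus>\<^bsub>Y\<^esub> ?x) + nrm Y (?x \<ominus>\<^bsub>Y\<^esub> z)"
      by (rule Y.nrm_triangle) (use x Y in auto)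
    then show ?thesis
      using span_code(2)[OF y, of n] span_code(2)[OF z, of n] n Y.nrm_minus_commute[of z ?x] x Y eq
      by simp
  qed
  have "nrm Y (y \<ominus>\<^bsub>Y\<^esub> z) = 0"
    using *[of "nrm Y (y \<ominus>\<^bsub>Y\<^esub> z)"] Y.nrm_nonneg[of "y \<ominus>\<^bsub>Y\<^esub> z"] Y
    by (metis Y.M.minus_closed less_eq_real_def less_irrefl)
  then show "y = z" using Y.nrm_eq_0D Y.minus_eq_zeroD Y by blast
qed

lemma transported_closed_span: "transported_bimodule A Y l r closed_span span_code"
proof -
  obtain K1 where K1: "\<forall>a\<in>carrier A. \<forall>y\<in>carrier Y. nrm Y (l a y) \<le> K1 * nrm A a * nrm Y y"
    using l_bounded by blast
  obtain K2 where K2: "\<forall>a\<in>carrier A. \<forall>y\<in>carrier Y. nrm Y (r y a) \<le> K2 * nrm A a * nrm Y y"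
    using r_bounded by blast
  have sub: "closed_span \<subseteq> carrier Y" by (auto simp: closed_span_def)
  show ?thesis
  proof (intro transported_bimodule.intro banach_bimodule_axioms transported_bimodule_axioms.intro
      sub inj_on_span_code closed_span_add)
    show "\<zero>\<^bsub>Y\<^esub> \<in> closed_span" using G_zero G_subset_closed_span by blast
    show "c \<odot>\<^bsub>Y\<^esub> x \<in> closed_span" if x: "x \<in> closed_span" for c x
    proof (rule closed_span_map[OF _ x, where K = "cmod c"])
      fix z assume z: "z \<in> carrier Y"
      have "c \<odot>\<^bsub>Y\<^esub> x \<ominus>\<^bsub>Y\<^esub> c \<odot>\<^bsub>Y\<^esub> z = c \<odot>\<^bsub>Y\<^esub> (x \<ominus>\<^bsub>Y\<^esub> z)"
        using x sub z by (auto simp: a_minus_def Y.smult_r_distr Y.smult_r_minus)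
      then show "nrm Y (c \<odot>\<^bsub>Y\<^esub> x \<ominus>\<^bsub>Y\<^esub> c \<odot>\<^bsub>Y\<^esub> z) \<le> cmod c * nrm Y (x \<ominus>\<^bsub>Y\<^esub> z)"
        using x sub z Y.nrm_smult[of "x \<ominus>\<^bsub>Y\<^esub> z" c] by auto
    qed (auto simp: G_smult)
    show "l a x \<in> closed_span" if a: "a \<in> carrier A" and x: "x \<in> closed_span" for a x
      by (rule closed_span_map[OF _ x, where K = "K1 * nrm A a"])
        (use a x sub K1 in \<open>auto simp: G_l l_closed simp flip: l_minus\<close>)
    show "r x a \<in> closed_span" if a: "a \<in> carrier A" and x: "x \<in> closed_span" for a x
      by (rule closed_span_map[OF _ x, where K = "K2 * nrm A a" and T = "\<lambda>x. r x a"])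
        (use a x sub K2 in \<open>auto simp: G_r r_closed simp flip: r_minus\<close>)
    show "y \<in> closed_span"
      if y: "y \<in> carrier Y" and lim: "\<And>e. e > 0 \<Longrightarrow> \<exists>x\<in>closed_span. nrm Y (y \<ominus>\<^bsub>Y\<^esub> x) < e" for y
    proof -
      have "\<exists>z\<in>G. nrm Y (y \<ominus>\<^bsub>Y\<^esub> z) < e" if "e > 0" for e
      proof -
        from that have e: "e / 2 > 0" by simp
        obtain x where x: "x \<in> closed_span" "nrm Y (y \<ominus>\<^bsub>Y\<^esub> x) < e / 2" using lim[OF e] by blast
        then obtain z where z: "z \<in> G" "nrm Y (x \<ominus>\<^bsub>Y\<^esub> z) < e / 2"
          using e unfolding closed_span_def by blast
        have "nrm Y (y \<ominus>\<^bsub>Y\<^esub> z) \<le> nrm Y (y \<ominus>\<^bsub>Y\<^esub> x) + nrm Y (x \<ominus>\<^bsub>Y\<^esub> z)"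
          by (rule Y.nrm_triangle) (use y x z sub G_carrier in auto)
        then show ?thesis using x(2) z by (intro bexI[of _ z]) auto
      qed
      then show ?thesis using y by (simp add: closed_span_def)
    qed
  qed
qed

end

end

theorem boundedly_approximately_contractible_universal:
  assumes "boundedly_approximately_contractible A"
  shows "boundedly_approximately_contractible_on TYPE('y) A"
  unfolding boundedly_approximately_contractible_on_def
proof (intro allI impI)
  fix Y :: "'y normed_module" and l r D
  assume Y: "banach_bimodule A Y l r" and D: "continuous_derivation A Y l r D"
  interpret banach_bimodule A Y l r by (rule Y)
  interpret transported_bimodule A Y l r "closed_span D" "span_code D"
    by (rule transported_closed_span[OF D])
  have DS: "D a \<in> closed_span D" if "a \<in> carrier A" for a
    using G_subset_closed_span[OF D] derivation_span.base[OF that] by blast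
  show "boundedly_approximately_inner A Y l r D"
  proof (rule inner_transported[OF _ DS])
    show "boundedly_approximately_inner A Y' l' r' (\<lambda>a. span_code D (D a))"
      using assms bimodule_transported continuous_derivation_transported[OF D DS]
      unfolding boundedly_approximately_contractible_def boundedly_approximately_contractible_on_def
      by blast
  qed
qed


section \<open>Nets and filters\<close>

lemma boundedly_approximately_inner_if_net:
  fixes I :: "'i set" and prec :: "'i \<Rightarrow> 'i \<Rightarrow> bool" and T :: "'i \<Rightarrow> 'a \<Rightarrow> 'y"
  assumes "I \<noteq> {}"
    and refl: "\<And>i. i \<in> I \<Longrightarrow> prec i i"
    and trans: "\<And>i j k. i \<in> I \<Longrightarrow> j \<in> I \<Longrightarrow> k \<in> I \<Longrightarrow> prec i j \<Longrightarrow> prec j k \<Longrightarrow> prec i k"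
    and directed: "\<And>i j. i \<in> I \<Longrightarrow> j \<in> I \<Longrightarrow> \<exists>k\<in>I. prec i k \<and> prec j k"
    and inner: "\<And>i. i \<in> I \<Longrightarrow> inner_derivation A Y l r (T i)"
    and bounded: "\<And>i a. i \<in> I \<Longrightarrow> a \<in> carrier A \<Longrightarrow> nrm Y (T i a) \<le> M * nrm A a"
    and conv: "\<And>a e. a \<in> carrier A \<Longrightarrow> e > 0 \<Longrightarrow>
      \<exists>i\<in>I. \<forall>k\<in>I. prec i k \<longrightarrow> \<bar>nrm Y (T k a \<ominus>\<^bsub>Y\<^esub> D a)\<bar> < e"
  shows "boundedly_approximately_inner A Y l r D"
proof -
  define F where "F = (INF i\<in>I. principal (T ` {k \<in> I. prec i k}))"
  have ev: "eventually P F \<longleftrightarrow> (\<exists>i\<in>I. \<forall>k\<in>I. prec i k \<longrightarrow> P (T k))" for P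
    unfolding F_def
  proof (subst eventually_INF_base)
    fix i j assume ij: "i \<in> I" "j \<in> I"
    then obtain k where k: "k \<in> I" "prec i k" "prec j k" using directed by blast
    with ij show "\<exists>k\<in>I. principal (T ` {n \<in> I. prec k n}) \<le>
        inf (principal (T ` {n \<in> I. prec i n})) (principal (T ` {n \<in> I. prec j n}))"
      by (intro bexI[of _ k]) (auto intro: trans)
  qed (use \<open>I \<noteq> {}\<close> in \<open>auto simp: eventually_principal\<close>)
  have "F \<noteq> bot"
    unfolding trivial_limit_def ev using refl by blast
  moreover have "\<forall>\<^sub>F S in F. inner_derivation A Y l r S \<and> (\<forall>a\<in>carrier A. nrm Y (S a) \<le> M * nrm A a)"
    unfolding ev using \<open>I \<noteq> {}\<close> inner bounded by blast
  moreover have "((\<lambda>S. nrm Y (S a \<ominus>\<^bsub>Y\<^esub> D a)) \<longlongrightarrow> 0) F" if "a \<in> carrier A" for a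
    unfolding tendsto_iff ev using conv[OF that] by simp
  ultimately show ?thesis unfolding boundedly_approximately_inner_def by blast
qed

lemma net_if_boundedly_approximately_inner:
  fixes A :: "('a, 'c) normed_module_scheme"
  assumes "boundedly_approximately_inner A Y l r D"
  defines "I \<equiv> {(K :: 'a set, n :: nat). finite K \<and> K \<subseteq> carrier A}"
    and "prec \<equiv> \<lambda>(K, n) (K', n'). K \<subseteq> K' \<and> n \<le> n'"
  obtains T M where
    "\<And>i. i \<in> I \<Longrightarrow> inner_derivation A Y l r (T i)"
    "\<And>i a. i \<in> I \<Longrightarrow> a \<in> carrier A \<Longrightarrow> nrm Y (T i a) \<le> M * nrm A a"
    "\<And>a e. a \<in> carrier A \<Longrightarrow> e > 0 \<Longrightarrow>
      \<exists>i\<in>I. \<forall>k\<in>I. prec i k \<longrightarrow> \<bar>nrm Y (T k a \<ominus>\<^bsub>Y\<^esub> D a)\<bar> < e"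
proof -
  obtain F M where F: "F \<noteq> bot"
    and ev: "\<forall>\<^sub>F T in F. inner_derivation A Y l r T \<and> (\<forall>a\<in>carrier A. nrm Y (T a) \<le> M * nrm A a)"
    and lim: "\<And>a. a \<in> carrier A \<Longrightarrow> ((\<lambda>T. nrm Y (T a \<ominus>\<^bsub>Y\<^esub> D a)) \<longlongrightarrow> 0) F"
    using assms(1) unfolding boundedly_approximately_inner_def by blast
  have "\<exists>T. (inner_derivation A Y l r T \<and> (\<forall>a\<in>carrier A. nrm Y (T a) \<le> M * nrm A a)) \<and>
      (\<forall>a\<in>fst i. \<bar>nrm Y (T a \<ominus>\<^bsub>Y\<^esub> D a)\<bar> < inverse (real (Suc (snd i))))" if "i \<in> I" for i
  proof -
    have "\<forall>\<^sub>F T in F. \<forall>a\<in>fst i. \<bar>nrm Y (T a \<ominus>\<^bsub>Y\<^esub> D a)\<bar> < inverse (real (Suc (snd i)))"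
    proof (rule eventually_ball_finite)
      show "finite (fst i)" using that by (auto simp: I_def)
      show "\<forall>a\<in>fst i. \<forall>\<^sub>F T in F. \<bar>nrm Y (T a \<ominus>\<^bsub>Y\<^esub> D a)\<bar> < inverse (real (Suc (snd i)))"
      proof
        fix a assume "a \<in> fst i"
        then have "a \<in> carrier A" using that by (auto simp: I_def)
        from tendstoD[OF lim[OF this], of "inverse (real (Suc (snd i)))"]
        show "\<forall>\<^sub>F T in F. \<bar>nrm Y (T a \<ominus>\<^bsub>Y\<^esub> D a)\<bar> < inverse (real (Suc (snd i)))" by simp
      qed
    qed
    from eventually_conj[OF ev this] show ?thesis
      using F eventually_happens by (metis (no_types, lifting))
  qed
  then obtain T where T: "\<And>i. i \<in> I \<Longrightarrow> inner_derivation A Y l r (T i)"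
      "\<And>i a. i \<in> I \<Longrightarrow> a \<in> carrier A \<Longrightarrow> nrm Y (T i a) \<le> M * nrm A a"
      "\<And>i a. i \<in> I \<Longrightarrow> a \<in> fst i \<Longrightarrow> \<bar>nrm Y (T i a \<ominus>\<^bsub>Y\<^esub> D a)\<bar> < inverse (real (Suc (snd i)))"
    by metis
  show thesis
  proof (rule that[of T M, OF T(1,2)])
    fix a e assume a: "a \<in> carrier A" and "e > (0::real)"
    then obtain n where n: "inverse (real (Suc n)) < e" using reals_Archimedean by blast
    have "\<bar>nrm Y (T k a \<ominus>\<^bsub>Y\<^esub> D a)\<bar> < e" if k: "k \<in> I" "prec ({a}, n) k" for k
    proof -
      have "a \<in> fst k" "n \<le> snd k" using k(2) by (auto simp: prec_def split: prod.splits)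
      then have "inverse (real (Suc (snd k))) \<le> inverse (real (Suc n))" by (simp add: field_simps)
      with T(3)[OF k(1) \<open>a \<in> fst k\<close>] n show ?thesis by linarith
    qed
    moreover have "({a}, n) \<in> I" using a by (simp add: I_def)
    ultimately show "\<exists>i\<in>I. \<forall>k\<in>I. prec i k \<longrightarrow> \<bar>nrm Y (T k a \<ominus>\<^bsub>Y\<^esub> D a)\<bar> < e" by blast
  qed
qed

section \<open>Little Lipschitz algebras are Banach algebras\<close>

locale little_lipschitz =
  fixes X :: "'x::metric_space set" and \<alpha> :: real
  assumes compact_X: "compact X" and infinite_X: "infinite X" and alpha_pos: "0 < \<alpha>"
begin

abbreviation Q where "Q \<equiv> lip_quotients \<alpha> X"
abbreviation A where "A \<equiv> lip_algebra \<alpha> X"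

lemma lip_algebra_simps [simp]:
  "carrier A = lip_functions \<alpha> X"
  "f \<otimes>\<^bsub>A\<^esub> g = (\<lambda>x\<in>X. f x * g x)" "\<one>\<^bsub>A\<^esub> = (\<lambda>x\<in>X. 1)" "\<zero>\<^bsub>A\<^esub> = (\<lambda>x\<in>X. 0)"
  "f \<oplus>\<^bsub>A\<^esub> g = (\<lambda>x\<in>X. f x + g x)" "c \<odot>\<^bsub>A\<^esub> f = (\<lambda>x\<in>X. c * f x)"
  "nrm A f = (SUP x\<in>X. cmod (f x)) + Sup (Q f)"
  by (simp_all add: lip_algebra_def)

lemma quotient_le_iff:
  assumes "x \<noteq> y"
  shows "cmod (f x - f y) / dist x y powr \<alpha> \<le> C \<longleftrightarrow> cmod (f x - f y) \<le> C * dist x y powr \<alpha>"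
  using assms by (simp add: divide_le_eq)

definition hoelder where
  "hoelder f C \<longleftrightarrow> (\<forall>x\<in>X. \<forall>y\<in>X. cmod (f x - f y) \<le> C * dist x y powr \<alpha>)"

lemma hoelder_iff: "hoelder f C \<longleftrightarrow> (\<forall>q\<in>Q f. q \<le> C)"
  unfolding hoelder_def lip_quotients_def
proof safe
  fix x y assume "\<forall>x\<in>X. \<forall>y\<in>X. cmod (f x - f y) \<le> C * dist x y powr \<alpha>" "x \<in> X" "y \<in> X" "x \<noteq> y"
  then show "cmod (f x - f y) / dist x y powr \<alpha> \<le> C" by (simp add: quotient_le_iff)
next
  fix x y assume *: "\<forall>q\<in>{cmod (f x - f y) / dist x y powr \<alpha> | x y. x \<in> X \<and> y \<in> X \<and> x \<noteq> y}. q \<le> C"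
    "x \<in> X" "y \<in> X"
  show "cmod (f x - f y) \<le> C * dist x y powr \<alpha>"
  proof (cases "x = y")
    case False
    then have "cmod (f x - f y) / dist x y powr \<alpha> \<le> C" using * by blast
    then show ?thesis using False by (simp add: quotient_le_iff)
  qed simp
qed

lemma Q_nonempty: "Q f \<noteq> {}"
proof -
  obtain x where "x \<in> X" using infinite_X by fastforce
  moreover obtain y where "y \<in> X" "y \<noteq> x"
    using infinite_remove[OF infinite_X, of x] by (metis Diff_iff finite.emptyI insertI1 ex_in_conv)
  ultimately show ?thesis unfolding lip_quotients_def by blast
qed

lemma X_nonempty: "X \<noteq> {}" using infinite_X by auto

definition little where
  "little f \<longleftrightarrow> (\<forall>e>0. \<exists>d>0. \<forall>x\<in>X. \<forall>y\<in>X. dist x y < d \<longrightarrow> cmod (f x - f y) \<le> e * dist x y powr \<alpha>)"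

lemma lip_functions_iff:
  "f \<in> lip_functions \<alpha> X \<longleftrightarrow> f \<in> extensional X \<and> (\<exists>C. hoelder f C) \<and> little f"
proof -
  have "bdd_above (Q f) \<longleftrightarrow> (\<exists>C. hoelder f C)"
    unfolding hoelder_iff bdd_above_def ..
  moreover have "(\<forall>e>0. \<exists>d>0. \<forall>x\<in>X. \<forall>y\<in>X. 0 < dist x y \<longrightarrow> dist x y < d \<longrightarrow>
            cmod (f x - f y) / dist x y powr \<alpha> < e) \<longleftrightarrow> little f" (is "?L \<longleftrightarrow> _")
  proof
    assume L: ?L
    show "little f" unfolding little_def
    proof (intro allI impI)
      fix e :: real assume "e > 0"
      then obtain d where d: "d > 0" "\<forall>x\<in>X. \<forall>y\<in>X. 0 < dist x y \<longrightarrow> dist x y < d \<longrightarrow>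
            cmod (f x - f y) / dist x y powr \<alpha> < e" using L by blast
      have "cmod (f x - f y) \<le> e * dist x y powr \<alpha>" if "x \<in> X" "y \<in> X" "dist x y < d" for x y
      proof (cases "x = y")
        case False
        then have "cmod (f x - f y) / dist x y powr \<alpha> < e" using d that by simp
        then show ?thesis using quotient_le_iff[OF False, of f e] by simp
      qed simp
      then show "\<exists>d>0. \<forall>x\<in>X. \<forall>y\<in>X. dist x y < d \<longrightarrow> cmod (f x - f y) \<le> e * dist x y powr \<alpha>"
        using d(1) by blast
    qed
  next
    assume L: "little f"
    show ?L
    proof (intro allI impI)
      fix e :: real assume "e > 0"
      then have "e / 2 > 0" by simp
      then obtain d where d: "d > 0" "\<forall>x\<in>X. \<forall>y\<in>X. dist x y < d \<longrightarrow>
            cmod (f x - f y) \<le> e / 2 * dist x y powr \<alpha>" using L unfolding little_def by blast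
      have "cmod (f x - f y) / dist x y powr \<alpha> < e"
        if "x \<in> X" "y \<in> X" "0 < dist x y" "dist x y < d" for x y
      proof -
        have "cmod (f x - f y) / dist x y powr \<alpha> \<le> e / 2"
          using d that quotient_le_iff[of x y f "e / 2"] by fastforce
        also have "\<dots> < e" using \<open>e > 0\<close> by simp
        finally show ?thesis .
      qed
      then show "\<exists>d>0. \<forall>x\<in>X. \<forall>y\<in>X. 0 < dist x y \<longrightarrow> dist x y < d \<longrightarrow>
            cmod (f x - f y) / dist x y powr \<alpha> < e" using d(1) by blast
    qed
  qed
  ultimately show ?thesis unfolding lip_functions_def by auto
qed

abbreviation N where "N f \<equiv> SUP x\<in>X. cmod (f x)"
abbreviation L where "L f \<equiv> Sup (Q f)"

lemma hoelder_L: assumes "hoelder f C" shows "hoelder f (L f)"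
proof -
  have "bdd_above (Q f)" using assms unfolding hoelder_iff bdd_above_def by blast
  then show ?thesis unfolding hoelder_iff by (simp add: cSup_upper)
qed

lemma L_le: "hoelder f C \<Longrightarrow> L f \<le> C"
  unfolding hoelder_iff using Q_nonempty by (intro cSup_least) auto

lemma L_nonneg: "hoelder f C \<Longrightarrow> 0 \<le> L f"
proof -
  assume f: "hoelder f C"
  obtain q where q: "q \<in> Q f" using Q_nonempty by blast
  then have "q \<ge> 0" unfolding lip_quotients_def by auto
  moreover have "q \<le> L f" using hoelder_L[OF f] q unfolding hoelder_iff by blast
  ultimately show ?thesis by linarith
qed

lemma bdd_N: assumes "hoelder f C" shows "bdd_above ((\<lambda>x. cmod (f x)) ` X)"
proof -
  obtain x0 where x0: "x0 \<in> X" using X_nonempty by blast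
  obtain B where B: "\<And>x. x \<in> X \<Longrightarrow> dist x x0 \<le> B"
    using compact_imp_bounded[OF compact_X] unfolding bounded_any_center[where a = x0]
    by (metis dist_commute)
  have "cmod (f x) \<le> cmod (f x0) + L f * B powr \<alpha>" if "x \<in> X" for x
  proof -
    have "cmod (f x) \<le> cmod (f x0) + cmod (f x - f x0)"
      by (metis add.commute diff_add_cancel norm_triangle_ineq)
    also have "cmod (f x - f x0) \<le> L f * dist x x0 powr \<alpha>"
      using hoelder_L[OF assms] that x0 by (simp add: hoelder_def)
    also have "\<dots> \<le> L f * B powr \<alpha>"
      using B[OF that] alpha_pos L_nonneg[OF assms]
      by (intro mult_left_mono powr_mono2) auto
    finally show ?thesis by simp
  qed
  then show ?thesis by (intro bdd_aboveI2)
qed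

lemma N_ge: "hoelder f C \<Longrightarrow> x \<in> X \<Longrightarrow> cmod (f x) \<le> N f"
  by (rule cSUP_upper[OF _ bdd_N])

lemma N_le: "(\<And>x. x \<in> X \<Longrightarrow> cmod (f x) \<le> C) \<Longrightarrow> N f \<le> C"
  by (rule cSUP_least[OF X_nonempty])

lemma N_nonneg: "hoelder f C \<Longrightarrow> 0 \<le> N f"
  using N_ge X_nonempty by (metis ex_in_conv norm_ge_zero order_trans)

lemma hoelder_cong: "(\<And>x. x \<in> X \<Longrightarrow> f x = g x) \<Longrightarrow> hoelder f C = hoelder g C"
  by (simp add: hoelder_def)

lemma hoelder_add:
  assumes "hoelder f C" "hoelder g D" shows "hoelder (\<lambda>x\<in>X. f x + g x) (C + D)"
  unfolding hoelder_def
proof (intro ballI)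
  fix x y assume xy: "x \<in> X" "y \<in> X"
  have "cmod (f x + g x - (f y + g y)) \<le> cmod (f x - f y) + cmod (g x - g y)"
    by (metis add_diff_add norm_triangle_ineq)
  also have "\<dots> \<le> C * dist x y powr \<alpha> + D * dist x y powr \<alpha>"
    using assms xy by (intro add_mono) (auto simp: hoelder_def)
  finally show "cmod ((\<lambda>x\<in>X. f x + g x) x - (\<lambda>x\<in>X. f x + g x) y) \<le> (C + D) * dist x y powr \<alpha>"
    using xy by (simp add: algebra_simps)
qed

lemma hoelder_smult:
  assumes "hoelder f C" shows "hoelder (\<lambda>x\<in>X. c * f x) (cmod c * C)"
  unfolding hoelder_def
proof (intro ballI)
  fix x y assume xy: "x \<in> X" "y \<in> X"
  have "cmod (c * f x - c * f y) = cmod c * cmod (f x - f y)"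
    by (metis norm_mult right_diff_distrib)
  also have "\<dots> \<le> cmod c * (C * dist x y powr \<alpha>)"
    using assms xy by (intro mult_left_mono) (auto simp: hoelder_def)
  finally show "cmod ((\<lambda>x\<in>X. c * f x) x - (\<lambda>x\<in>X. c * f x) y) \<le> cmod c * C * dist x y powr \<alpha>"
    using xy by (simp add: mult.assoc)
qed

lemma mult_diff_le:
  assumes "hoelder f C" "hoelder g D" "x \<in> X" "y \<in> X"
  shows "cmod (f x * g x - f y * g y) \<le> N f * cmod (g x - g y) + N g * cmod (f x - f y)"
proof -
  have "f x * g x - f y * g y = f x * (g x - g y) + g y * (f x - f y)" by (simp add: algebra_simps)
  then have "cmod (f x * g x - f y * g y) \<le> cmod (f x) * cmod (g x - g y) + cmod (g y) * cmod (f x - f y)"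
    by (metis norm_mult norm_triangle_ineq)
  also have "\<dots> \<le> N f * cmod (g x - g y) + N g * cmod (f x - f y)"
    using N_ge assms by (intro add_mono mult_right_mono) auto
  finally show ?thesis .
qed

lemma hoelder_mult:
  assumes "hoelder f C" "hoelder g D" shows "hoelder (\<lambda>x\<in>X. f x * g x) (N f * L g + N g * L f)"
  unfolding hoelder_def
proof (intro ballI)
  fix x y assume xy: "x \<in> X" "y \<in> X"
  have "cmod (f x * g x - f y * g y) \<le> N f * cmod (g x - g y) + N g * cmod (f x - f y)"
    by (rule mult_diff_le[OF assms xy])
  also have "\<dots> \<le> N f * (L g * dist x y powr \<alpha>) + N g * (L f * dist x y powr \<alpha>)"
    using hoelder_L[OF assms(1)] hoelder_L[OF assms(2)] xy N_nonneg[OF assms(1)] N_nonneg[OF assms(2)]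
    by (intro add_mono mult_left_mono) (auto simp: hoelder_def)
  finally show "cmod ((\<lambda>x\<in>X. f x * g x) x - (\<lambda>x\<in>X. f x * g x) y) \<le> (N f * L g + N g * L f) * dist x y powr \<alpha>"
    using xy by (simp add: algebra_simps)
qed

lemma little_bound:
  assumes f: "little f" and g: "little g" and K: "K \<ge> 0"
    and le: "\<And>x y. x \<in> X \<Longrightarrow> y \<in> X \<Longrightarrow> cmod (h x - h y) \<le> K * (cmod (f x - f y) + cmod (g x - g y))"
  shows "little h"
  unfolding little_def
proof (intro allI impI)
  fix e :: real assume e: "e > 0"
  define e' where "e' = e / (2 * (K + 1))"
  have e': "e' > 0" using e K by (simp add: e'_def)
  obtain d1 where d1: "d1 > 0" "\<forall>x\<in>X. \<forall>y\<in>X. dist x y < d1 \<longrightarrow> cmod (f x - f y) \<le> e' * dist x y powr \<alpha>"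
    using f e' unfolding little_def by blast
  obtain d2 where d2: "d2 > 0" "\<forall>x\<in>X. \<forall>y\<in>X. dist x y < d2 \<longrightarrow> cmod (g x - g y) \<le> e' * dist x y powr \<alpha>"
    using g e' unfolding little_def by blast
  have "cmod (h x - h y) \<le> e * dist x y powr \<alpha>" if "x \<in> X" "y \<in> X" "dist x y < min d1 d2" for x y
  proof -
    have "cmod (h x - h y) \<le> K * (cmod (f x - f y) + cmod (g x - g y))" by (rule le[OF that(1,2)])
    also have "\<dots> \<le> (K + 1) * (e' * dist x y powr \<alpha> + e' * dist x y powr \<alpha>)"
      using d1 d2 that K by (intro mult_mono add_mono) auto
    also have "\<dots> = ((K + 1) * (2 * e')) * dist x y powr \<alpha>" by (simp add: algebra_simps)
    also have "(K + 1) * (2 * e') = e" using K by (simp add: e'_def field_simps)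
    finally show ?thesis .
  qed
  then show "\<exists>d>0. \<forall>x\<in>X. \<forall>y\<in>X. dist x y < d \<longrightarrow> cmod (h x - h y) \<le> e * dist x y powr \<alpha>"
    using d1(1) d2(1) by (intro exI[of _ "min d1 d2"]) auto
qed

lemma lip_add: "f \<in> lip_functions \<alpha> X \<Longrightarrow> g \<in> lip_functions \<alpha> X \<Longrightarrow> (\<lambda>x\<in>X. f x + g x) \<in> lip_functions \<alpha> X"
  unfolding lip_functions_iff
  by (auto intro: hoelder_add little_bound[of f g 1]
      simp: add_diff_add norm_triangle_ineq)

lemma lip_smult: "f \<in> lip_functions \<alpha> X \<Longrightarrow> (\<lambda>x\<in>X. c * f x) \<in> lip_functions \<alpha> X"
  unfolding lip_functions_iff
  by (auto intro: hoelder_smult little_bound[of f f "cmod c"] simp: norm_mult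
      simp flip: right_diff_distrib)

lemma lip_mult:
  assumes "f \<in> lip_functions \<alpha> X" "g \<in> lip_functions \<alpha> X"
  shows "(\<lambda>x\<in>X. f x * g x) \<in> lip_functions \<alpha> X"
proof -
  obtain C D where CD: "hoelder f C" "hoelder g D" "little f" "little g"
    using assms unfolding lip_functions_iff by blast
  have "little (\<lambda>x\<in>X. f x * g x)"
  proof (rule little_bound[OF CD(3,4), of "N f + N g"])
    show "0 \<le> N f + N g" using N_nonneg CD by (metis add_nonneg_nonneg)
    fix x y assume xy: "x \<in> X" "y \<in> X"
    have "cmod (f x * g x - f y * g y) \<le> N f * cmod (g x - g y) + N g * cmod (f x - f y)"
      by (rule mult_diff_le[OF CD(1,2) xy])
    also have "\<dots> \<le> (N f + N g) * (cmod (f x - f y) + cmod (g x - g y))"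
      using N_nonneg[OF CD(1)] N_nonneg[OF CD(2)] by (simp add: algebra_simps)
    finally show "cmod ((\<lambda>x\<in>X. f x * g x) x - (\<lambda>x\<in>X. f x * g x) y) \<le>
        (N f + N g) * (cmod (f x - f y) + cmod (g x - g y))" using xy by simp
  qed
  then show ?thesis using hoelder_mult[OF CD(1,2)] unfolding lip_functions_iff by auto
qed

lemma lip_zero: "(\<lambda>x\<in>X. 0) \<in> lip_functions \<alpha> X"
  unfolding lip_functions_iff hoelder_def little_def by (auto intro: exI[of _ 0] exI[of _ 1])

lemma abelian_group_lip: "abelian_group A"
proof (rule abelian_groupI)
  fix f assume f: "f \<in> carrier A"
  show "\<exists>g\<in>carrier A. g \<oplus>\<^bsub>A\<^esub> f = \<zero>\<^bsub>A\<^esub>"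
    using f lip_smult[of f "-1"] by (intro bexI[of _ "\<lambda>x\<in>X. -1 * f x"]) (auto cong: restrict_cong)
next
  fix f assume "f \<in> carrier A"
  then have "f \<in> extensional X" by (simp add: lip_functions_iff)
  then show "\<zero>\<^bsub>A\<^esub> \<oplus>\<^bsub>A\<^esub> f = f"
    by (simp cong: restrict_cong add: extensional_restrict)
qed (auto simp: lip_add lip_zero algebra_simps cong: restrict_cong)

lemma module_lip: "module complex_field A"
proof (rule moduleI[OF cring_complex_field abelian_group_lip])
  fix f assume "f \<in> carrier A"
  then have "f \<in> extensional X" by (simp add: lip_functions_iff)
  then show "\<one>\<^bsub>complex_field\<^esub> \<odot>\<^bsub>A\<^esub> f = f"
    by (simp cong: restrict_cong add: extensional_restrict)
qed (auto simp: lip_smult algebra_simps cong: restrict_cong)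

lemma normed_lip: "complex_normed_space A"
proof (intro complex_normed_space.intro module_lip complex_normed_space_axioms.intro)
  fix f assume f: "f \<in> carrier A"
  then obtain C where C: "hoelder f C" and ext: "f \<in> extensional X" by (auto simp: lip_functions_iff)
  {
    assume "nrm A f = 0"
    then have "N f = 0" using N_nonneg[OF C] L_nonneg[OF C] by simp
    then have "f x = 0" if "x \<in> X" for x using N_ge[OF C that] by simp
    then show "f = \<zero>\<^bsub>A\<^esub>" using ext by (auto simp: extensional_def fun_eq_iff)
  }
  fix c
  have le: "nrm A (c \<odot>\<^bsub>A\<^esub> g) \<le> cmod c * nrm A g" if g: "hoelder g D" for c g D
  proof -
    have "N (\<lambda>x\<in>X. c * g x) \<le> cmod c * N g"
      by (rule N_le) (simp add: norm_mult mult_left_mono N_ge[OF g])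
    moreover have "L (\<lambda>x\<in>X. c * g x) \<le> cmod c * L g"
      by (rule L_le[OF hoelder_smult[OF hoelder_L[OF g]]])
    ultimately show ?thesis by (simp add: algebra_simps)
  qed
  show "nrm A (c \<odot>\<^bsub>A\<^esub> f) = cmod c * nrm A f"
  proof (cases "c = 0")
    case True
    have "0 \<le> nrm A (c \<odot>\<^bsub>A\<^esub> f)"
      using N_nonneg[OF hoelder_smult[OF C]] L_nonneg[OF hoelder_smult[OF C]] by simp
    then show ?thesis using le[OF C, of c] True by simp
  next
    case False
    have "(inverse c) \<odot>\<^bsub>A\<^esub> (c \<odot>\<^bsub>A\<^esub> f) = f"
      using False ext by (simp cong: restrict_cong add: extensional_restrict flip: mult.assoc)
    then have "nrm A f \<le> cmod (inverse c) * nrm A (c \<odot>\<^bsub>A\<^esub> f)"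
      using le[OF hoelder_smult[OF C], of "inverse c" c] by simp
    then have "cmod c * nrm A f \<le> cmod c * (cmod (inverse c) * nrm A (c \<odot>\<^bsub>A\<^esub> f))"
      by (rule mult_left_mono) simp
    also have "\<dots> = nrm A (c \<odot>\<^bsub>A\<^esub> f)"
      using False unfolding mult.assoc[symmetric] norm_mult[symmetric] by simp
    finally have "cmod c * nrm A f \<le> nrm A (c \<odot>\<^bsub>A\<^esub> f)" .
    then show ?thesis using le[OF C, of c] by linarith
  qed
next
  fix f g assume "f \<in> carrier A" "g \<in> carrier A"
  then obtain C D where C: "hoelder f C" "hoelder g D" by (auto simp: lip_functions_iff)
  have "N (\<lambda>x\<in>X. f x + g x) \<le> N f + N g"
    by (rule N_le) (use N_ge[OF C(1)] N_ge[OF C(2)] in \<open>auto intro: norm_triangle_le add_mono\<close>)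
  moreover have "L (\<lambda>x\<in>X. f x + g x) \<le> L f + L g"
    by (rule L_le[OF hoelder_add[OF hoelder_L[OF C(1)] hoelder_L[OF C(2)]]])
  ultimately show "nrm A (f \<oplus>\<^bsub>A\<^esub> g) \<le> nrm A f + nrm A g" by simp
qed

lemma minus_lip:
  assumes "f \<in> lip_functions \<alpha> X" "g \<in> lip_functions \<alpha> X"
  shows "f \<ominus>\<^bsub>A\<^esub> g = (\<lambda>x\<in>X. f x - g x)"
proof -
  interpret complex_normed_space A by (rule normed_lip)
  show ?thesis using assms by (simp add: a_minus_def uminus_smult cong: restrict_cong)
qed

lemma banach_lip: "complex_banach_space A"
proof -
  interpret complex_normed_space A by (rule normed_lip)
  have "\<exists>f\<in>carrier A. \<forall>e>0. \<exists>n0. \<forall>n\<ge>n0. nrm A (s n \<ominus>\<^bsub>A\<^esub> f) < e"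
    if s: "\<forall>n. s n \<in> carrier A"
      and C: "\<forall>e>0. \<exists>n0. \<forall>m\<ge>n0. \<forall>n\<ge>n0. nrm A (s m \<ominus>\<^bsub>A\<^esub> s n) < e" for s :: "nat \<Rightarrow> 'x \<Rightarrow> complex"
  proof -
    have sl: "s n \<in> lip_functions \<alpha> X" for n using s by simp
    have dl: "(\<lambda>x\<in>X. s m x - s n x) \<in> lip_functions \<alpha> X" for m n
      using minus_lip[OF sl sl, of m n] M.minus_closed[of "s m" "s n"] sl by simp
    have Cau: "\<exists>n0. \<forall>m\<ge>n0. \<forall>n\<ge>n0. (\<forall>x\<in>X. cmod (s m x - s n x) \<le> e) \<and>
        (\<forall>x\<in>X. \<forall>y\<in>X. cmod ((s m x - s n x) - (s m y - s n y)) \<le> e * dist x y powr \<alpha>)"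
      if e: "e > 0" for e
    proof -
      obtain n0 where n0: "\<And>m n. m \<ge> n0 \<Longrightarrow> n \<ge> n0 \<Longrightarrow> nrm A (s m \<ominus>\<^bsub>A\<^esub> s n) < e"
        using C e by blast
      show ?thesis
      proof (intro exI[of _ n0] allI impI)
        fix m n assume mn: "m \<ge> n0" "n \<ge> n0"
        let ?h = "\<lambda>x\<in>X. s m x - s n x"
        obtain K where K: "hoelder ?h K" using dl[of m n] unfolding lip_functions_iff by blast
        have "N ?h + L ?h < e" using n0[OF mn] by (simp add: minus_lip sl)
        then have NL: "N ?h \<le> e" "L ?h \<le> e" using N_nonneg[OF K] L_nonneg[OF K] by linarith+
        have 1: "cmod (s m x - s n x) \<le> e" if "x \<in> X" for x
          using N_ge[OF K that] NL(1) that by simp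
        have 2: "cmod ((s m x - s n x) - (s m y - s n y)) \<le> e * dist x y powr \<alpha>"
          if "x \<in> X" "y \<in> X" for x y
        proof -
          have "cmod (?h x - ?h y) \<le> L ?h * dist x y powr \<alpha>"
            using hoelder_L[OF K] that unfolding hoelder_def by blast
          also have "\<dots> \<le> e * dist x y powr \<alpha>" by (rule mult_right_mono[OF NL(2)]) simp
          finally show ?thesis using that by simp
        qed
        show "(\<forall>x\<in>X. cmod (s m x - s n x) \<le> e) \<and>
          (\<forall>x\<in>X. \<forall>y\<in>X. cmod ((s m x - s n x) - (s m y - s n y)) \<le> e * dist x y powr \<alpha>)"
          using 1 2 by blast
      qed
    qed
    have "convergent (\<lambda>n. s n x)" if x: "x \<in> X" for x
    proof (rule Cauchy_convergent, rule metric_CauchyI)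
      fix e :: real assume "e > 0"
      then have "e / 2 > 0" by simp
      from Cau[OF this] x obtain n0 where "\<forall>m\<ge>n0. \<forall>n\<ge>n0. cmod (s m x - s n x) \<le> e / 2" by blast
      then show "\<exists>M. \<forall>m\<ge>M. \<forall>n\<ge>M. dist (s m x) (s n x) < e"
        using \<open>e > 0\<close> unfolding dist_norm by (intro exI[of _ n0]) force
    qed
    then have lim: "(\<lambda>n. s n x) \<longlonglongrightarrow> lim (\<lambda>n. s n x)" if "x \<in> X" for x
      using that convergent_LIMSEQ_iff by blast
    define f where "f = (\<lambda>x\<in>X. lim (\<lambda>n. s n x))"
    have lim: "(\<lambda>n. s n x) \<longlonglongrightarrow> f x" if "x \<in> X" for x
      using lim[OF that] that by (simp add: f_def)
    have est: "\<exists>n0. \<forall>m\<ge>n0. (\<forall>x\<in>X. cmod (s m x - f x) \<le> e) \<and>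
        (\<forall>x\<in>X. \<forall>y\<in>X. cmod ((s m x - f x) - (s m y - f y)) \<le> e * dist x y powr \<alpha>)"
      if e: "e > 0" for e
    proof -
      obtain n0 where n0: "\<And>m n x. m \<ge> n0 \<Longrightarrow> n \<ge> n0 \<Longrightarrow> x \<in> X \<Longrightarrow> cmod (s m x - s n x) \<le> e"
        "\<And>m n x y. m \<ge> n0 \<Longrightarrow> n \<ge> n0 \<Longrightarrow> x \<in> X \<Longrightarrow> y \<in> X \<Longrightarrow>
            cmod ((s m x - s n x) - (s m y - s n y)) \<le> e * dist x y powr \<alpha>"
        using Cau[OF e] by blast
      have 1: "cmod (s m x - f x) \<le> e" if "m \<ge> n0" "x \<in> X" for m x
        by (rule LIMSEQ_le_const2[OF tendsto_norm[OF tendsto_diff[OF tendsto_const lim[OF that(2)]]]])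
          (use n0(1) that in blast)
      have 2: "cmod ((s m x - f x) - (s m y - f y)) \<le> e * dist x y powr \<alpha>"
        if "m \<ge> n0" "x \<in> X" "y \<in> X" for m x y
        by (rule LIMSEQ_le_const2[OF tendsto_norm[OF tendsto_diff[OF
              tendsto_diff[OF tendsto_const lim[OF that(2)]] tendsto_diff[OF tendsto_const lim[OF that(3)]]]]])
          (use n0(2) that in blast)
      from 1 2 show ?thesis by blast
    qed
    have ext: "f \<in> extensional X" by (simp add: f_def)
    have "\<exists>C. hoelder f C"
    proof -
      obtain m where m: "hoelder (\<lambda>x. s m x - f x) 1"
        using est[of 1] unfolding hoelder_def by fastforce
      obtain K where "hoelder (s m) K" using sl unfolding lip_functions_iff by blast
      from hoelder_add[OF this hoelder_smult[OF m, of "-1"]]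
      have "hoelder f (K + cmod (-1) * 1)"
        by (subst hoelder_cong[of f]) auto
      then show ?thesis by blast
    qed
    moreover have "little f"
      unfolding little_def
    proof (intro allI impI)
      fix e :: real assume "e > 0"
      then have e: "e / 2 > 0" by simp
      obtain m where m: "\<And>x y. x \<in> X \<Longrightarrow> y \<in> X \<Longrightarrow>
          cmod ((s m x - f x) - (s m y - f y)) \<le> e / 2 * dist x y powr \<alpha>"
        using est[OF e] by blast
      obtain d where d: "d > 0" "\<And>x y. x \<in> X \<Longrightarrow> y \<in> X \<Longrightarrow> dist x y < d \<Longrightarrow>
          cmod (s m x - s m y) \<le> e / 2 * dist x y powr \<alpha>"
        using sl[of m] e unfolding lip_functions_iff little_def by blast
      have "cmod (f x - f y) \<le> e * dist x y powr \<alpha>" if "x \<in> X" "y \<in> X" "dist x y < d" for x y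
      proof -
        have "f x - f y = (s m x - s m y) - ((s m x - f x) - (s m y - f y))" by simp
        then have "cmod (f x - f y) \<le> cmod (s m x - s m y) + cmod ((s m x - f x) - (s m y - f y))"
          by (metis norm_triangle_ineq4)
        then show ?thesis using d(2)[OF that] m[OF that(1,2)] by (simp add: field_simps)
      qed
      then show "\<exists>d>0. \<forall>x\<in>X. \<forall>y\<in>X. dist x y < d \<longrightarrow> cmod (f x - f y) \<le> e * dist x y powr \<alpha>"
        using d(1) by blast
    qed
    ultimately have f: "f \<in> lip_functions \<alpha> X" using ext unfolding lip_functions_iff by blast
    show ?thesis
    proof (intro bexI[of _ f] allI impI)
      fix e :: real assume "e > 0"
      then have e: "e / 3 > 0" by simp
      obtain n0 where n0: "\<And>m. m \<ge> n0 \<Longrightarrow> (\<forall>x\<in>X. cmod (s m x - f x) \<le> e / 3) \<and>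
          (\<forall>x\<in>X. \<forall>y\<in>X. cmod ((s m x - f x) - (s m y - f y)) \<le> e / 3 * dist x y powr \<alpha>)"
        using est[OF e] by blast
      have "nrm A (s n \<ominus>\<^bsub>A\<^esub> f) < e" if n: "n \<ge> n0" for n
      proof -
        let ?h = "\<lambda>x\<in>X. s n x - f x"
        have "N ?h \<le> e / 3" by (rule N_le) (use n0[OF n] in auto)
        moreover have "L ?h \<le> e / 3" by (rule L_le) (use n0[OF n] in \<open>auto simp: hoelder_def\<close>)
        ultimately have "N ?h + L ?h < e" using \<open>e > 0\<close> by linarith
        then show ?thesis by (simp add: minus_lip sl f)
      qed
      then show "\<exists>n0. \<forall>n\<ge>n0. nrm A (s n \<ominus>\<^bsub>A\<^esub> f) < e" by blast
    qed (use f in simp)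
  qed
  then show ?thesis
    by (intro complex_banach_space.intro normed_lip complex_banach_space_axioms.intro)
      (unfold mcomplete_nrm_iff, blast)
qed

theorem banach_algebra_lip: "complex_banach_algebra A"
proof (intro complex_banach_algebra.intro banach_lip complex_banach_algebra_axioms.intro)
  fix f g assume "f \<in> carrier A" "g \<in> carrier A"
  then obtain C D where C: "hoelder f C" "hoelder g D" by (auto simp: lip_functions_iff)
  have "N (\<lambda>x\<in>X. f x * g x) \<le> N f * N g"
    by (rule N_le) (use N_ge[OF C(1)] N_ge[OF C(2)] N_nonneg[OF C(1)] in
        \<open>auto simp: norm_mult intro!: mult_mono\<close>)
  moreover have "L (\<lambda>x\<in>X. f x * g x) \<le> N f * L g + N g * L f"
    by (rule L_le[OF hoelder_mult[OF C]])
  moreover have "0 \<le> L f * L g" using L_nonneg[OF C(1)] L_nonneg[OF C(2)] by simp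
  ultimately show "nrm A (f \<otimes>\<^bsub>A\<^esub> g) \<le> nrm A f * nrm A g" by (simp add: algebra_simps)
qed (auto simp: lip_mult algebra_simps cong: restrict_cong)

end

end

theory Submission
  imports Defs
begin

text \<open>
  Let \<open>x0\<close> be an accumulation point of \<open>X\<close> and \<open>\<rho> z = d(z, x0)\<^sup>\<alpha>\<close>. Consider the
  functions \<open>G\<close> on \<open>X \<times> X\<close> with \<open>G(x0, x0) = 0\<close> whose mixed differences
  \<open>G(z, w) - G(x0, w) - G(z, x0)\<close> are \<open>O(\<rho> z \<rho> w)\<close> and for which \<open>G(z, x0) = O(\<rho> z)\<close>
  and \<open>G(x0, w) = O(\<rho> w)\<close>. They form a Banach bimodule, on which \<open>a\<close> acts by multiplication
  with \<open>a(z)\<close> from the left and \<open>a(w)\<close> from the right, and \<open>D a = a(z) - a(w)\<close> is a bounded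
  derivation into it. Suppose inner derivations given by \<open>G\<^sub>i\<close> converge to \<open>D\<close> and are bounded
  by \<open>M\<close>. Then \<open>G\<^sub>i(z, x0) \<longlongrightarrow> 1\<close> for \<open>z \<noteq> x0\<close>. On the other hand, for
  \<open>d(w, x0) \<le> d(z, x0)\<close>, evaluating the mixed difference at \<open>(z, w)\<close> on
  \<open>a = min 1 (d(\<cdot>, x0) / d(w, x0))\<close>, of norm at most \<open>1 + 1 / \<rho> w\<close>, gives
  \<open>\<bar>G\<^sub>i(x0, w) - G\<^sub>i(z, x0)\<bar> \<le> M \<rho> z (1 + \<rho> w)\<close>, and \<open>w \<longlongrightarrow> x0\<close>
  gives \<open>\<bar>G\<^sub>i(z, x0)\<bar> \<le> M \<rho> z\<close>. Hence \<open>1 \<le> M \<rho> z\<close>, which fails for \<open>z\<close> near \<open>x0\<close>.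
\<close>

section \<open>Spaces of bounded functions\<close>

text \<open>Functions on \<open>S\<close> are extended by 0, so the norm is a supremum over the
  whole type, which is nonempty even if \<open>S\<close> is empty.\<close>

definition bounded_functions :: "'i set \<Rightarrow> ('i \<Rightarrow> complex) normed_module" where
  "bounded_functions S =
     \<lparr>carrier = {f. (\<forall>i. i \<notin> S \<longrightarrow> f i = 0) \<and> bounded (range f)},
      mult = (\<lambda>f g i. f i * g i), one = (\<lambda>i. of_bool (i \<in> S)), zero = (\<lambda>i. 0),
      add = (\<lambda>f g i. f i + g i), smult = (\<lambda>c f i. c * f i),
      nrm = (\<lambda>f. SUP i. cmod (f i))\<rparr>"

lemma bounded_functions_simps [simp]:
  "\<zero>\<^bsub>bounded_functions S\<^esub> = (\<lambda>i. 0)"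
  "f \<oplus>\<^bsub>bounded_functions S\<^esub> g = (\<lambda>i. f i + g i)"
  "c \<odot>\<^bsub>bounded_functions S\<^esub> f = (\<lambda>i. c * f i)"
  by (simp_all add: bounded_functions_def)

lemma bounded_functionsI:
  assumes "\<And>i. i \<notin> S \<Longrightarrow> f i = 0" "\<And>i. cmod (f i) \<le> K"
  shows "f \<in> carrier (bounded_functions S)"
  using assms unfolding bounded_functions_def bounded_iff by auto

lemma bounded_functionsD:
  "f \<in> carrier (bounded_functions S) \<Longrightarrow> i \<notin> S \<Longrightarrow> f i = 0"
  by (simp add: bounded_functions_def)

lemma nrm_bounded_functions_le:
  "(\<And>i. cmod (f i) \<le> K) \<Longrightarrow> nrm (bounded_functions S) f \<le> K"
  unfolding bounded_functions_def by (auto intro: cSUP_least)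

lemma nrm_bounded_functions_ge:
  assumes "f \<in> carrier (bounded_functions S)"
  shows "cmod (f i) \<le> nrm (bounded_functions S) f"
proof -
  have "bdd_above (range (\<lambda>i. cmod (f i)))"
    using assms unfolding bounded_functions_def bounded_iff by (auto simp: bdd_above_def)
  then show ?thesis using cSUP_upper[of i UNIV "\<lambda>i. cmod (f i)"] by (simp add: bounded_functions_def)
qed

lemma add_bounded_functions:
  assumes "f \<in> carrier (bounded_functions S)" "g \<in> carrier (bounded_functions S)"
  shows "(\<lambda>i. f i + g i) \<in> carrier (bounded_functions S)"
proof (rule bounded_functionsI)
  show "f i + g i = 0" if "i \<notin> S" for i using that by (simp add: assms[THEN bounded_functionsD])
  show "cmod (f i + g i) \<le> nrm (bounded_functions S) f + nrm (bounded_functions S) g" for i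
    by (intro norm_triangle_le add_mono nrm_bounded_functions_ge assms)
qed

lemma smult_bounded_functions:
  assumes "f \<in> carrier (bounded_functions S)"
  shows "(\<lambda>i. c * f i) \<in> carrier (bounded_functions S)"
proof (rule bounded_functionsI)
  show "c * f i = 0" if "i \<notin> S" for i using that by (simp add: assms[THEN bounded_functionsD])
  show "cmod (c * f i) \<le> cmod c * nrm (bounded_functions S) f" for i
    by (simp add: norm_mult mult_left_mono nrm_bounded_functions_ge[OF assms])
qed

lemma abelian_group_bounded_functions: "abelian_group (bounded_functions S)"
proof (rule abelian_groupI)
  fix f assume "f \<in> carrier (bounded_functions S)"
  then show "\<exists>g\<in>carrier (bounded_functions S). g \<oplus>\<^bsub>bounded_functions S\<^esub> f = \<zero>\<^bsub>bounded_functions S\<^esub>"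
    using smult_bounded_functions[of f S "-1"] by (intro bexI[of _ "\<lambda>i. -1 * f i"]) auto
qed (auto simp: add_bounded_functions algebra_simps intro: bounded_functionsI[where K = 0])

lemma normed_bounded_functions: "complex_normed_space (bounded_functions S)"
proof (intro complex_normed_space.intro complex_normed_space_axioms.intro)
  show "module complex_field (bounded_functions S)"
    by (rule moduleI[OF cring_complex_field abelian_group_bounded_functions])
      (auto simp: smult_bounded_functions algebra_simps)
  fix f assume f: "f \<in> carrier (bounded_functions S)"
  show "f = \<zero>\<^bsub>bounded_functions S\<^esub>" if "nrm (bounded_functions S) f = 0"
    using nrm_bounded_functions_ge[OF f] that by auto
  fix c
  show "nrm (bounded_functions S) (c \<odot>\<^bsub>bounded_functions S\<^esub> f) = cmod c * nrm (bounded_functions S) f"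
  proof (rule antisym)
    show "nrm (bounded_functions S) (c \<odot>\<^bsub>bounded_functions S\<^esub> f) \<le> cmod c * nrm (bounded_functions S) f"
      by (rule nrm_bounded_functions_le)
        (simp add: norm_mult mult_left_mono nrm_bounded_functions_ge[OF f])
    show "cmod c * nrm (bounded_functions S) f \<le> nrm (bounded_functions S) (c \<odot>\<^bsub>bounded_functions S\<^esub> f)"
    proof (cases "c = 0")
      case True
      then show ?thesis by (simp add: bounded_functions_def)
    next
      case False
      have "nrm (bounded_functions S) f \<le> nrm (bounded_functions S) (\<lambda>i. c * f i) / cmod c"
      proof (rule nrm_bounded_functions_le)
        fix i
        show "cmod (f i) \<le> nrm (bounded_functions S) (\<lambda>i. c * f i) / cmod c"
          using nrm_bounded_functions_ge[OF smult_bounded_functions[OF f, of c], of i] False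
          by (simp add: norm_mult field_simps)
      qed
      then show ?thesis using False by (simp add: field_simps)
    qed
  qed
next
  fix f g assume fg: "f \<in> carrier (bounded_functions S)" "g \<in> carrier (bounded_functions S)"
  show "nrm (bounded_functions S) (f \<oplus>\<^bsub>bounded_functions S\<^esub> g) \<le>
      nrm (bounded_functions S) f + nrm (bounded_functions S) g"
    unfolding bounded_functions_simps
    by (intro nrm_bounded_functions_le norm_triangle_le add_mono nrm_bounded_functions_ge fg)
qed

lemma minus_bounded_functions:
  assumes "f \<in> carrier (bounded_functions S)" "g \<in> carrier (bounded_functions S)"
  shows "f \<ominus>\<^bsub>bounded_functions S\<^esub> g = (\<lambda>i. f i - g i)"
proof -
  interpret complex_normed_space "bounded_functions S" by (rule normed_bounded_functions)
  show ?thesis using assms by (simp add: a_minus_def uminus_smult)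
qed

text \<open>Norm convergence is uniform convergence, so the limit exists by the uniform Cauchy
  criterion; boundedness and vanishing off \<open>S\<close> pass to it.\<close>

lemma banach_bounded_functions: "complex_banach_space (bounded_functions S)"
proof -
  let ?V = "bounded_functions S"
  interpret complex_normed_space ?V by (rule normed_bounded_functions)
  have "\<exists>f\<in>carrier ?V. \<forall>e>0. \<exists>n0. \<forall>n\<ge>n0. nrm ?V (s n \<ominus>\<^bsub>?V\<^esub> f) < e"
    if s: "\<forall>n. s n \<in> carrier ?V"
      and C: "\<forall>e>0. \<exists>n0. \<forall>m\<ge>n0. \<forall>n\<ge>n0. nrm ?V (s m \<ominus>\<^bsub>?V\<^esub> s n) < e" for s :: "nat \<Rightarrow> 'a \<Rightarrow> complex"
  proof -
    have "uniformly_Cauchy_on UNIV s"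
      unfolding uniformly_Cauchy_on_def
    proof (intro allI impI)
      fix e :: real assume "e > 0"
      then obtain n0 where n0: "\<And>m n. m \<ge> n0 \<Longrightarrow> n \<ge> n0 \<Longrightarrow> nrm ?V (s m \<ominus>\<^bsub>?V\<^esub> s n) < e"
        using C by blast
      have "dist (s m i) (s n i) < e" if "m \<ge> n0" "n \<ge> n0" for m n i
      proof -
        have "cmod ((s m \<ominus>\<^bsub>?V\<^esub> s n) i) \<le> nrm ?V (s m \<ominus>\<^bsub>?V\<^esub> s n)"
          using s by (intro nrm_bounded_functions_ge M.minus_closed) auto
        then show ?thesis
          using n0[OF that] minus_bounded_functions[of "s m" S "s n"] s by (simp add: dist_norm)
      qed
      then show "\<exists>n0. \<forall>i\<in>UNIV. \<forall>m\<ge>n0. \<forall>n\<ge>n0. dist (s m i) (s n i) < e" by blast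
    qed
    then obtain f where f: "uniform_limit UNIV s f sequentially"
      unfolding uniformly_convergent_eq_Cauchy[symmetric] uniformly_convergent_on_def by blast
    have est: "\<exists>n0. \<forall>n\<ge>n0. \<forall>i. cmod (s n i - f i) < e" if "e > 0" for e
      using f that unfolding uniform_limit_iff eventually_sequentially dist_norm by auto
    have fV: "f \<in> carrier ?V"
    proof -
      obtain n where n: "\<And>i. cmod (s n i - f i) < 1" using est[of 1] by auto
      show ?thesis
      proof (rule bounded_functionsI)
        fix i
        show "cmod (f i) \<le> nrm ?V (s n) + 1"
          using n[of i] nrm_bounded_functions_ge[of "s n" S i] s
            norm_triangle_ineq2[of "f i" "s n i"] by (simp add: norm_minus_commute)
        assume "i \<notin> S"
        then have "(\<lambda>n. s n i) = (\<lambda>_. 0)" using bounded_functionsD s by fast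
        then show "f i = 0"
          using tendsto_uniform_limitI[OF f, of i] by (simp add: LIMSEQ_const_iff)
      qed
    qed
    show ?thesis
    proof (intro bexI[of _ f] fV allI impI)
      fix e :: real assume "e > 0"
      then obtain n0 where n0: "\<And>n i. n \<ge> n0 \<Longrightarrow> cmod (s n i - f i) < e / 2"
        using est[of "e / 2"] by auto
      have "nrm ?V (s n \<ominus>\<^bsub>?V\<^esub> f) < e" if "n \<ge> n0" for n
      proof -
        \<comment> \<open>Values below \<open>e / 2\<close> bound their supremum only by
          \<open>e / 2\<close> itself, hence the halving.\<close>
        have "nrm ?V (s n \<ominus>\<^bsub>?V\<^esub> f) \<le> e / 2"
          by (rule nrm_bounded_functions_le)
            (use n0[OF that] s fV in \<open>auto simp: minus_bounded_functions less_imp_le\<close>)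
        then show ?thesis using \<open>e > 0\<close> by linarith
      qed
      then show "\<exists>n0. \<forall>n\<ge>n0. nrm ?V (s n \<ominus>\<^bsub>?V\<^esub> f) < e" by blast
    qed
  qed
  then show ?thesis
    by (intro complex_banach_space.intro normed_bounded_functions complex_banach_space_axioms.intro)
      (unfold mcomplete_nrm_iff, blast)
qed


section \<open>The bimodule of mixed differences\<close>

locale little_lipschitz_point = little_lipschitz +
  fixes x0
  assumes x0: "x0 \<in> X" "x0 islimpt X"
begin

text \<open>
  A function \<open>G\<close> as above is represented by the bounded function \<open>h\<close> with
  \<open>h (z, w) = (G(z, w) - G(x0, w) - G(z, x0)) / (\<rho> z \<rho> w)\<close>,
  \<open>h (z, x0) = G(z, x0) / \<rho> z\<close> and \<open>h (x0, w) = G(x0, w) / \<rho> w\<close>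
  for \<open>z \<noteq> x0\<close> and \<open>w \<noteq> x0\<close>.
\<close>

abbreviation Y where "Y \<equiv> bounded_functions (X \<times> X - {(x0, x0)})"

abbreviation \<rho> where "\<rho> z \<equiv> dist z x0 powr \<alpha>"

text \<open>At \<open>z = x0\<close> the quotient is \<open>0 / 0 = 0\<close>, as it should be.\<close>

definition \<delta> :: "('a \<Rightarrow> complex) \<Rightarrow> 'a \<Rightarrow> complex" where
  "\<delta> a z = (if z \<in> X then (a z - a x0) / of_real (\<rho> z) else 0)"

text \<open>The mixed difference of a(z) G(z, w) is a(z) times that of G plus (a(z) - a(x0)) G(x0,
  w). Dividing by \<rho> z \<rho> w gives this formula. On the axes the second term vanishes, as
  \<open>\<delta> a x0 = 0\<close> and \<open>h (x0, x0) = 0\<close>. The action \<open>r\<close> is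
  the mirror image.\<close>

definition l :: "('a \<Rightarrow> complex) \<Rightarrow> ('a \<times> 'a \<Rightarrow> complex) \<Rightarrow> 'a \<times> 'a \<Rightarrow> complex" where
  "l a h = (\<lambda>(z, w). a z * h (z, w) + \<delta> a z * h (x0, w))"

definition r :: "('a \<times> 'a \<Rightarrow> complex) \<Rightarrow> ('a \<Rightarrow> complex) \<Rightarrow> 'a \<times> 'a \<Rightarrow> complex" where
  "r h a = (\<lambda>(z, w). a w * h (z, w) + \<delta> a w * h (z, x0))"

text \<open>All mixed differences of a(z) - a(w) vanish, so only its values on the axes
  \<open>z = x0\<close> and \<open>w = x0\<close> remain.\<close>

definition D :: "('a \<Rightarrow> complex) \<Rightarrow> 'a \<times> 'a \<Rightarrow> complex" where
  "D a = (\<lambda>(z, w). (if w = x0 then \<delta> a z else 0) - (if z = x0 then \<delta> a w else 0))"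

section \<open>Difference quotients at \<open>x0\<close> and the module axioms\<close>

lemma \<delta>_x0 [simp]: "\<delta> a x0 = 0"
  by (simp add: \<delta>_def)

lemma \<delta>_outside [simp]: "z \<notin> X \<Longrightarrow> \<delta> a z = 0"
  by (simp add: \<delta>_def)

lemma \<delta>_add: "\<delta> (\<lambda>x\<in>X. a x + b x) z = \<delta> a z + \<delta> b z"
  using x0 by (simp add: \<delta>_def add_divide_distrib diff_divide_distrib)

lemma \<delta>_smult: "\<delta> (\<lambda>x\<in>X. t * a x) z = t * \<delta> a z"
  using x0 by (simp add: \<delta>_def diff_divide_distrib right_diff_distrib)

text \<open>This splitting fits \<open>l\<close>, which applies \<open>b\<close> first: in the term
  \<open>\<delta> a z\<close>, the inner action is evaluated at \<open>(x0, w)\<close> and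
  contributes \<open>b x0\<close>. For \<open>r\<close> the order is reversed, hence the second form
  \<open>\<delta>_mult'\<close>.\<close>

lemma \<delta>_mult: "\<delta> (\<lambda>x\<in>X. a x * b x) z = a z * \<delta> b z + \<delta> a z * b x0"
  using x0 by (simp add: \<delta>_def add_divide_distrib[symmetric] algebra_simps)

lemma \<delta>_mult': "\<delta> (\<lambda>x\<in>X. a x * b x) z = b z * \<delta> a z + \<delta> b z * a x0"
  using \<delta>_mult[of b a z] by (simp add: mult.commute)

lemma norm_\<delta>_le:
  assumes "hoelder a C" shows "cmod (\<delta> a z) \<le> L a"
proof (cases "z \<in> X \<and> z \<noteq> x0")
  case True
  then have "cmod (a z - a x0) \<le> L a * \<rho> z"
    using hoelder_L[OF assms] x0 unfolding hoelder_def by blast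
  then show ?thesis using True by (simp add: \<delta>_def norm_divide divide_le_eq)
next
  case False
  then show ?thesis using L_nonneg[OF assms] by (auto simp: \<delta>_def)
qed

text \<open>One estimate for both actions: \<open>N a\<close> controls the first term and
  \<open>L a\<close> the second, and they add up to the norm. Off \<open>X\<close> the value
  \<open>a z\<close> is \<open>undefined\<close>, so there \<open>h i\<close> has to vanish.\<close>

lemma action_le:
  assumes a: "a \<in> lip_functions \<alpha> X" and h: "h \<in> carrier Y"
    and p: "p = a z * h i + \<delta> a z * h j" and out: "z \<notin> X \<Longrightarrow> h i = 0"
  shows "cmod p \<le> nrm A a * nrm Y h"
proof -
  obtain C where C: "hoelder a C" using a by (auto simp: lip_functions_iff)
  have *: "cmod (a z * h i) \<le> N a * nrm Y h"
  proof (cases "z \<in> X")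
    case True
    then show ?thesis
      unfolding norm_mult by (intro mult_mono N_ge[OF C] N_nonneg[OF C] nrm_bounded_functions_ge[OF h]) auto
  next
    case False
    have "0 \<le> nrm Y h" using nrm_bounded_functions_ge[OF h, of i] norm_ge_zero order_trans by blast
    then show ?thesis using out[OF False] N_nonneg[OF C] by simp
  qed
  have "cmod (\<delta> a z * h j) \<le> L a * nrm Y h"
    unfolding norm_mult by (intro mult_mono norm_\<delta>_le[OF C] L_nonneg[OF C] nrm_bounded_functions_ge[OF h]) auto
  then have "cmod (a z * h i) + cmod (\<delta> a z * h j) \<le> nrm A a * nrm Y h"
    using * by (simp add: distrib_right)
  then show ?thesis unfolding p by (rule norm_triangle_le)
qed

lemma norm_l_le:
  assumes "a \<in> lip_functions \<alpha> X" "h \<in> carrier Y"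
  shows "cmod (l a h i) \<le> nrm A a * nrm Y h"
  by (cases i)
    (rule action_le[OF assms, where z = "fst i"], auto simp: l_def intro: bounded_functionsD[OF assms(2)])

lemma norm_r_le:
  assumes "a \<in> lip_functions \<alpha> X" "h \<in> carrier Y"
  shows "cmod (r h a i) \<le> nrm A a * nrm Y h"
  by (cases i)
    (rule action_le[OF assms, where z = "snd i"], auto simp: r_def intro: bounded_functionsD[OF assms(2)])

lemma Y_outside:
  assumes "h \<in> carrier Y"
  shows "z \<notin> X \<or> w \<notin> X \<Longrightarrow> h (z, w) = 0" and "h (x0, x0) = 0"
  using bounded_functionsD[OF assms] by auto

lemma Y_index: "p \<notin> X \<times> X - {(x0, x0)} \<longleftrightarrow> (\<exists>z w. p = (z, w) \<and> (z \<notin> X \<or> w \<notin> X \<or> z = x0 \<and> w = x0))"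
  by (cases p) auto

lemma l_closed_Y: "a \<in> lip_functions \<alpha> X \<Longrightarrow> h \<in> carrier Y \<Longrightarrow> l a h \<in> carrier Y"
  by (rule bounded_functionsI[OF _ norm_l_le])
    (subst (asm) Y_index, auto simp: l_def Y_outside)

lemma r_closed_Y: "a \<in> lip_functions \<alpha> X \<Longrightarrow> h \<in> carrier Y \<Longrightarrow> r h a \<in> carrier Y"
  by (rule bounded_functionsI[OF _ norm_r_le])
    (subst (asm) Y_index, auto simp: r_def Y_outside)

text \<open>Operations of \<open>A\<close> yield \<open>undefined\<close> off \<open>X\<close>, but
  \<open>h\<close> vanishes there and hides it.\<close>

lemma restrict_mult_Y:
  assumes "h \<in> carrier Y"
  shows "(\<lambda>x\<in>X. f x) z * h (z, w) = f z * h (z, w)" "(\<lambda>x\<in>X. f x) w * h (z, w) = f w * h (z, w)"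
  using Y_outside[OF assms] by auto

lemma bimodule_Y: "banach_bimodule A Y l r"
proof (intro banach_bimodule.intro banach_algebra_lip banach_bounded_functions
    banach_bimodule_axioms.intro)
  show "\<exists>K. \<forall>a\<in>carrier A. \<forall>y\<in>carrier Y. nrm Y (l a y) \<le> K * nrm A a * nrm Y y"
    by (rule exI[of _ 1]) (use norm_l_le in \<open>auto intro!: nrm_bounded_functions_le\<close>)
  show "\<exists>K. \<forall>a\<in>carrier A. \<forall>y\<in>carrier Y. nrm Y (r y a) \<le> K * nrm A a * nrm Y y"
    by (rule exI[of _ 1]) (use norm_r_le in \<open>auto intro!: nrm_bounded_functions_le\<close>)
next
  fix a b y assume "a \<in> carrier A" "b \<in> carrier A" and y: "y \<in> carrier Y"
  show "l (a \<otimes>\<^bsub>A\<^esub> b) y = l a (l b y)"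
    using x0 by (auto simp: l_def restrict_mult_Y[OF y] Y_outside(1)[OF y] \<delta>_mult algebra_simps fun_eq_iff)
  show "r y (a \<otimes>\<^bsub>A\<^esub> b) = r (r y a) b"
    using x0 by (auto simp: r_def restrict_mult_Y[OF y] Y_outside(1)[OF y] \<delta>_mult' algebra_simps fun_eq_iff)
  show "r (l a y) b = l a (r y b)"
    by (auto simp: l_def r_def algebra_simps fun_eq_iff)
next
  fix a b y t assume "a \<in> carrier A" "b \<in> carrier A" and y: "y \<in> carrier Y"
  show "l (a \<oplus>\<^bsub>A\<^esub> b) y = l a y \<oplus>\<^bsub>Y\<^esub> l b y" "l (t \<odot>\<^bsub>A\<^esub> a) y = t \<odot>\<^bsub>Y\<^esub> l a y"
    "r y (a \<oplus>\<^bsub>A\<^esub> b) = r y a \<oplus>\<^bsub>Y\<^esub> r y b" "r y (t \<odot>\<^bsub>A\<^esub> a) = t \<odot>\<^bsub>Y\<^esub> r y a"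
    by (auto simp: l_def r_def restrict_mult_Y[OF y] Y_outside(1)[OF y] \<delta>_add \<delta>_smult
        algebra_simps fun_eq_iff)
next
  fix a y z t assume "a \<in> carrier A" "y \<in> carrier Y" "z \<in> carrier Y"
  show "l a (y \<oplus>\<^bsub>Y\<^esub> z) = l a y \<oplus>\<^bsub>Y\<^esub> l a z" "l a (t \<odot>\<^bsub>Y\<^esub> y) = t \<odot>\<^bsub>Y\<^esub> l a y"
    "r (y \<oplus>\<^bsub>Y\<^esub> z) a = r y a \<oplus>\<^bsub>Y\<^esub> r z a" "r (t \<odot>\<^bsub>Y\<^esub> y) a = t \<odot>\<^bsub>Y\<^esub> r y a"
    by (auto simp: l_def r_def algebra_simps fun_eq_iff)
qed (auto simp: l_closed_Y r_closed_Y)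

section \<open>The derivation into the bimodule\<close>

lemma norm_D_le:
  assumes "a \<in> lip_functions \<alpha> X" shows "cmod (D a i) \<le> nrm A a"
proof -
  obtain C where C: "hoelder a C" using assms by (auto simp: lip_functions_iff)
  \<comment> \<open>At most one of the two terms is nonzero: both occur only at
    \<open>(x0, x0)\<close>, where they are 0.\<close>
  have "cmod (D a i) \<le> L a"
    using norm_\<delta>_le[OF C] L_nonneg[OF C] by (auto simp: D_def split: prod.splits)
  then show ?thesis using N_nonneg[OF C] by simp
qed

lemma D_closed_Y: "a \<in> lip_functions \<alpha> X \<Longrightarrow> D a \<in> carrier Y"
  by (rule bounded_functionsI[OF _ norm_D_le])
    (subst (asm) Y_index, auto simp: D_def x0)

lemma D_minus:
  assumes "a \<in> lip_functions \<alpha> X" "b \<in> lip_functions \<alpha> X"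
  shows "D a \<ominus>\<^bsub>Y\<^esub> D b = D (a \<ominus>\<^bsub>A\<^esub> b)"
  using x0
  unfolding minus_bounded_functions[OF D_closed_Y[OF assms(1)] D_closed_Y[OF assms(2)]] minus_lip[OF assms]
  by (auto simp: D_def \<delta>_def fun_eq_iff diff_divide_distrib)

lemma derivation_D: "continuous_derivation A Y l r D"
  unfolding continuous_derivation_def
proof (intro conjI ballI)
  show "linear_map A Y D"
    unfolding linear_map_def
    by (intro conjI funcsetI ballI allI)
      (simp add: D_closed_Y, auto simp: D_def \<delta>_add \<delta>_smult fun_eq_iff algebra_simps)
  fix a b assume "a \<in> carrier A" "b \<in> carrier A"
  show "D (a \<otimes>\<^bsub>A\<^esub> b) = l a (D b) \<oplus>\<^bsub>Y\<^esub> r (D a) b"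
  proof
    fix p show "D (a \<otimes>\<^bsub>A\<^esub> b) p = (l a (D b) \<oplus>\<^bsub>Y\<^esub> r (D a) b) p"
    \<comment> \<open>Each axis needs its own form of the product rule. Off both axes the cross
      terms \<open>\<delta> a z * \<delta> b w\<close> from \<open>l\<close> and \<open>r\<close>
      have opposite signs and cancel.\<close>
    proof (cases "snd p = x0")
      case True
      then show ?thesis by (cases p) (auto simp: D_def l_def r_def \<delta>_mult algebra_simps)
    next
      case False
      then show ?thesis by (cases p) (auto simp: D_def l_def r_def \<delta>_mult' algebra_simps)
    qed
  qed
next
  interpret A: complex_banach_algebra A by (rule banach_algebra_lip)
  \<comment> \<open>\<open>D\<close> is a contraction, so continuity holds with radius
    \<open>e\<close> itself.\<close>
  have "nrm Y (D a \<ominus>\<^bsub>Y\<^esub> D b) \<le> nrm A (a \<ominus>\<^bsub>A\<^esub> b)" if "a \<in> carrier A" "b \<in> carrier A" for a b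
  proof -
    have "a \<ominus>\<^bsub>A\<^esub> b \<in> lip_functions \<alpha> X" using that A.M.minus_closed[of a b] by simp
    then show ?thesis
      using that D_minus[of a b] norm_D_le
      by (simp del: lip_algebra_simps(7) add: nrm_bounded_functions_le)
  qed
  then show "continuous_map (nrm_topology A) (nrm_topology Y) D"
    unfolding continuous_map_nrm_iff[OF A.complex_normed_space_axioms normed_bounded_functions]
    by (auto simp: D_closed_Y simp del: lip_algebra_simps(7) intro: order_le_less_trans)
qed


section \<open>Failure of bounded approximation\<close>

definition cutoff :: "'a \<Rightarrow> 'a \<Rightarrow> complex" where
  "cutoff w = (\<lambda>x\<in>X. of_real (min 1 (dist x x0 / dist w x0)))"

lemma cutoff_diff_le:
  assumes "w \<noteq> x0" "x \<in> X" "y \<in> X"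
  shows "cmod (cutoff w x - cutoff w y) \<le> min 1 (dist x y / dist w x0)"
proof -
  have s: "dist w x0 > 0" using assms by simp
  have m: "\<bar>min 1 u - min 1 v\<bar> \<le> min 1 \<bar>u - v\<bar>" if "u \<ge> 0" "v \<ge> 0" for u v :: real
    using that by (auto simp: min_def)
  have "cmod (cutoff w x - cutoff w y) =
      \<bar>min 1 (dist x x0 / dist w x0) - min 1 (dist y x0 / dist w x0)\<bar>"
    using assms unfolding cutoff_def by (simp flip: of_real_diff)
  also have "\<dots> \<le> min 1 \<bar>dist x x0 / dist w x0 - dist y x0 / dist w x0\<bar>"
    by (rule m) auto
  also have "\<dots> \<le> min 1 (dist x y / dist w x0)"
  proof -
    have "\<bar>dist x x0 / dist w x0 - dist y x0 / dist w x0\<bar> = \<bar>dist x x0 - dist y x0\<bar> / dist w x0"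
      using s by (simp add: diff_divide_distrib[symmetric])
    also have "\<dots> \<le> dist x y / dist w x0"
      using abs_dist_diff_le[of x x0 y, unfolded dist_commute[of x0 y]] s by (intro divide_right_mono) auto
    finally show ?thesis by simp
  qed
  finally show ?thesis .
qed

text \<open>With u = d(x, y) / d(w, x0) this turns the bound of \<open>cutoff_diff_le\<close> into
  d(x, y) to the power \<alpha> over \<rho> w, which gives the constant
  \<open>1 / \<rho> w\<close>.\<close>

lemma min_le_powr:
  fixes u :: real
  assumes "0 \<le> u" "\<alpha> \<le> 1" shows "min 1 u \<le> u powr \<alpha>"
proof (cases "u \<le> 1")
  case True
  then show ?thesis using assms powr_mono'[of \<alpha> 1 u] by auto
next
  case False
  then show ?thesis using ge_one_powr_ge_zero[of u \<alpha>] alpha_pos by auto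
qed

lemma hoelder_cutoff:
  assumes "\<alpha> \<le> 1" "w \<noteq> x0" shows "hoelder (cutoff w) (1 / \<rho> w)"
  unfolding hoelder_def
proof (intro ballI)
  fix x y assume xy: "x \<in> X" "y \<in> X"
  have "cmod (cutoff w x - cutoff w y) \<le> (dist x y / dist w x0) powr \<alpha>"
    using cutoff_diff_le[OF assms(2) xy] min_le_powr[OF _ assms(1), of "dist x y / dist w x0"]
    by (auto intro: order_trans)
  then show "cmod (cutoff w x - cutoff w y) \<le> 1 / \<rho> w * dist x y powr \<alpha>"
    by (simp add: powr_divide)
qed

text \<open>The cutoff is Lipschitz with exponent 1, and a power 1 - \<alpha> of the distance is
  left over. Truncating \<rho> instead of the distance would fail: its quotients against
  \<open>x0\<close> do not tend to 0.\<close>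

lemma little_cutoff:
  assumes "\<alpha> < 1" "w \<noteq> x0" shows "little (cutoff w)"
  unfolding little_def
proof (intro allI impI)
  fix e :: real assume e: "e > 0"
  \<comment> \<open>\<open>d\<close> solves
    \<open>d powr (1 - \<alpha>) = e * dist w x0\<close>.\<close>
  define d where "d = (e * dist w x0) powr (1 / (1 - \<alpha>))"
  have s: "dist w x0 > 0" using assms by simp
  have "cmod (cutoff w x - cutoff w y) \<le> e * dist x y powr \<alpha>"
    if xy: "x \<in> X" "y \<in> X" "dist x y < d" for x y
  proof -
    have "dist x y powr (1 - \<alpha>) \<le> d powr (1 - \<alpha>)"
      using xy(3) assms(1) by (intro powr_mono2) auto
    also have "\<dots> = e * dist w x0" using e s assms(1) by (simp add: d_def powr_powr)
    finally have "dist x y powr (1 - \<alpha>) * dist x y powr \<alpha> \<le> e * dist w x0 * dist x y powr \<alpha>"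
      by (rule mult_right_mono) simp
    then have "dist x y \<le> e * dist w x0 * dist x y powr \<alpha>" by (simp flip: powr_add)
    then have "dist x y / dist w x0 \<le> e * dist x y powr \<alpha>" using s by (simp add: field_simps)
    then show ?thesis using cutoff_diff_le[OF assms(2) xy(1,2)] by simp
  qed
  moreover have "d > 0" using e s by (simp add: d_def)
  ultimately show "\<exists>d>0. \<forall>x\<in>X. \<forall>y\<in>X. dist x y < d \<longrightarrow>
      cmod (cutoff w x - cutoff w y) \<le> e * dist x y powr \<alpha>" by blast
qed

lemma cutoff_lip: "\<alpha> < 1 \<Longrightarrow> w \<noteq> x0 \<Longrightarrow> cutoff w \<in> lip_functions \<alpha> X"
  unfolding lip_functions_iff using hoelder_cutoff[of w] little_cutoff[of w] by (auto simp: cutoff_def)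

lemma nrm_cutoff_le:
  assumes "\<alpha> < 1" "w \<noteq> x0" shows "nrm A (cutoff w) \<le> 1 + 1 / \<rho> w"
proof -
  have "N (cutoff w) \<le> 1" by (rule N_le) (simp add: cutoff_def)
  moreover have "L (cutoff w) \<le> 1 / \<rho> w" by (rule L_le[OF hoelder_cutoff]) (use assms in auto)
  ultimately show ?thesis by simp
qed

lemma cutoff_x0 [simp]: "cutoff w x0 = 0"
  using x0 by (simp add: cutoff_def)

lemma cutoff_eq_1: "z \<in> X \<Longrightarrow> w \<noteq> x0 \<Longrightarrow> dist w x0 \<le> dist z x0 \<Longrightarrow> cutoff w z = 1"
  by (simp add: cutoff_def min_def field_simps)

section \<open>Passing to the accumulation point\<close>

lemma exists_near_x0:
  assumes "e > 0" shows "\<exists>w\<in>X. w \<noteq> x0 \<and> dist w x0 \<le> e \<and> \<rho> w \<le> e"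
proof -
  have "0 < min e (e powr (1 / \<alpha>))" using assms by simp
  then obtain w where w: "w \<in> X" "w \<noteq> x0" "dist w x0 < min e (e powr (1 / \<alpha>))"
    using x0(2) unfolding islimpt_approachable by blast
  have "\<rho> w \<le> (e powr (1 / \<alpha>)) powr \<alpha>" using w alpha_pos by (intro powr_mono2) auto
  also have "\<dots> = e" using assms alpha_pos by (simp add: powr_powr)
  finally show ?thesis using w by auto
qed

text \<open>The bound depends on \<open>M\<close> only, not on the norm of \<open>h\<close>; this is
  where boundedness of the net enters. The norm \<open>K\<close> of \<open>h\<close> occurs in the
  estimate with factor \<open>\<rho> w\<close>, and \<open>w\<close> may be taken arbitrarily close
  to \<open>x0\<close>.\<close>

lemma slice_le:
  assumes h: "h \<in> carrier Y" and \<alpha>: "\<alpha> < 1" and M: "M \<ge> 0"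
    and T: "\<And>a. a \<in> carrier A \<Longrightarrow> nrm Y (l a h \<ominus>\<^bsub>Y\<^esub> r h a) \<le> M * nrm A a"
    and z: "z \<in> X" "z \<noteq> x0"
  shows "cmod (h (z, x0)) \<le> M"
proof (rule field_le_epsilon)
  fix e :: real assume e: "e > 0"
  define K where "K = nrm Y h"
  have K: "cmod (h i) \<le> K" for i unfolding K_def by (rule nrm_bounded_functions_ge[OF h])
  have K0: "K \<ge> 0" using K[of "(x0, x0)"] norm_ge_zero order_trans by blast
  have \<rho>z: "\<rho> z > 0" using z by simp
  \<comment> \<open>The first bound makes \<open>cutoff w\<close> equal to 1 at \<open>z\<close>;
    the second makes the error \<open>\<rho> w * (M + K / \<rho> z)\<close> at most
    \<open>e\<close>, with \<open>+ 1\<close> keeping the denominator positive.\<close>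
  define e' where "e' = min (dist z x0) (e / (M + K / \<rho> z + 1))"
  have B: "M + K / \<rho> z \<ge> 0" using M K0 \<rho>z by simp
  have "e' > 0" using z e B unfolding e'_def by (simp add: divide_pos_pos)
  then obtain w where w: "w \<in> X" "w \<noteq> x0" "dist w x0 \<le> e'" "\<rho> w \<le> e'"
    using exists_near_x0 by blast
  have \<rho>w: "\<rho> w > 0" using w by simp
  let ?a = "cutoff w"
  have a: "?a \<in> lip_functions \<alpha> X" by (rule cutoff_lip[OF \<alpha> w(2)])
  interpret Y: complex_normed_space Y by (rule normed_bounded_functions)
  have a1: "?a z = 1" "?a w = 1"
    using w z by (auto intro!: cutoff_eq_1 simp: e'_def)
  have "l ?a h \<ominus>\<^bsub>Y\<^esub> r h ?a \<in> carrier Y"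
    by (intro Y.M.minus_closed l_closed_Y r_closed_Y a h)
  from nrm_bounded_functions_ge[OF this, of "(z, w)"]
  have "cmod ((l ?a h \<ominus>\<^bsub>Y\<^esub> r h ?a) (z, w)) \<le> M * nrm A ?a"
    using T[of ?a] a by (simp del: lip_algebra_simps(7))
  also have "\<dots> \<le> M * (1 + 1 / \<rho> w)" by (rule mult_left_mono[OF nrm_cutoff_le[OF \<alpha> w(2)] M])
  \<comment> \<open>The terms \<open>h (z, w)\<close> cancel because the cutoff is 1 at both
    \<open>z\<close> and \<open>w\<close>.\<close>
  also have "(l ?a h \<ominus>\<^bsub>Y\<^esub> r h ?a) (z, w) =
      h (x0, w) / of_real (\<rho> z) - h (z, x0) / of_real (\<rho> w)"
    using a1 w z unfolding minus_bounded_functions[OF l_closed_Y[OF a h] r_closed_Y[OF a h]]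
    by (simp add: l_def r_def \<delta>_def)
  finally have "cmod (h (x0, w) / of_real (\<rho> z) - h (z, x0) / of_real (\<rho> w)) \<le> M * (1 + 1 / \<rho> w)" .
  moreover have "cmod (h (x0, w) / of_real (\<rho> z)) \<le> K / \<rho> z"
    using K \<rho>z by (simp add: norm_divide divide_right_mono)
  moreover have "cmod (h (z, x0) / of_real (\<rho> w)) = cmod (h (z, x0)) / \<rho> w"
    by (simp add: norm_divide)
  ultimately have "cmod (h (z, x0)) / \<rho> w \<le> K / \<rho> z + M * (1 + 1 / \<rho> w)"
    using norm_triangle_ineq2[of "h (z, x0) / of_real (\<rho> w)" "h (x0, w) / of_real (\<rho> z)"]
    by (simp add: norm_minus_commute)
  then have "\<rho> w * (cmod (h (z, x0)) / \<rho> w) \<le> \<rho> w * (K / \<rho> z + M * (1 + 1 / \<rho> w))"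
    by (rule mult_left_mono) simp
  also have "\<dots> = M + \<rho> w * (M + K / \<rho> z)" using \<rho>w w(2) by (simp add: algebra_simps)
  finally have "cmod (h (z, x0)) \<le> M + \<rho> w * (M + K / \<rho> z)" using \<rho>w w(2) by simp
  also have "\<rho> w * (M + K / \<rho> z) \<le> e / (M + K / \<rho> z + 1) * (M + K / \<rho> z + 1)"
    using w(4) B e by (intro mult_mono) (auto simp: e'_def)
  also have "\<dots> = e" using B by simp
  finally show "cmod (h (z, x0)) \<le> M + e" by simp
qed

lemma not_boundedly_approximately_inner_D:
  assumes \<alpha>: "\<alpha> < 1" shows "\<not> boundedly_approximately_inner A Y l r D"
proof
  assume "boundedly_approximately_inner A Y l r D"
  then obtain F M' where F: "F \<noteq> bot"
    and ev: "\<forall>\<^sub>F T in F. inner_derivation A Y l r T \<and> (\<forall>a\<in>carrier A. nrm Y (T a) \<le> M' * nrm A a)"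
    and lim: "\<And>a. a \<in> carrier A \<Longrightarrow> ((\<lambda>T. nrm Y (T a \<ominus>\<^bsub>Y\<^esub> D a)) \<longlongrightarrow> 0) F"
    unfolding boundedly_approximately_inner_def by blast
  interpret A: complex_normed_space A by (rule normed_lip)
  interpret Y: complex_normed_space Y by (rule normed_bounded_functions)
  \<comment> \<open>\<open>slice_le\<close> asks for a nonnegative bound, while \<open>M'\<close> is
    an arbitrary real.\<close>
  define M where "M = max M' 0"
  have bound: "1 / \<rho> z \<le> M" if z: "z \<in> X" "z \<noteq> x0" for z
  proof -
    let ?a = "cutoff z"
    have a: "?a \<in> lip_functions \<alpha> X" by (rule cutoff_lip[OF \<alpha> z(2)])
    have az: "?a z = 1" using z by (simp add: cutoff_eq_1)
    have ev': "\<forall>\<^sub>F T in F. 1 / \<rho> z - nrm Y (T ?a \<ominus>\<^bsub>Y\<^esub> D ?a) \<le> M"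
      using ev
    proof (rule eventually_mono)
      fix T assume T: "inner_derivation A Y l r T \<and> (\<forall>a\<in>carrier A. nrm Y (T a) \<le> M' * nrm A a)"
      then obtain h where h: "h \<in> carrier Y" and Th: "\<And>a. a \<in> carrier A \<Longrightarrow> T a = l a h \<ominus>\<^bsub>Y\<^esub> r h a"
        unfolding inner_derivation_def by blast
      have *: "nrm Y (l a h \<ominus>\<^bsub>Y\<^esub> r h a) \<le> M * nrm A a" if "a \<in> carrier A" for a
      proof -
        have "nrm Y (l a h \<ominus>\<^bsub>Y\<^esub> r h a) \<le> M' * nrm A a" using T Th that by metis
        also have "\<dots> \<le> M * nrm A a"
          by (rule mult_right_mono[OF _ A.nrm_nonneg[OF that]]) (simp add: M_def)
        finally show ?thesis .
      qed
      have hz: "cmod (h (z, x0)) \<le> M"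
        by (rule slice_le[OF h \<alpha> _ * z]) (simp_all add: M_def)
      have Ta: "T ?a \<in> carrier Y"
        using Th[of ?a] a h Y.M.minus_closed[OF l_closed_Y r_closed_Y] by simp
      \<comment> \<open>At \<open>(z, x0)\<close> the right action vanishes, as the cutoff is 0 at
        \<open>x0\<close>; the left action returns \<open>h (z, x0)\<close>, as it is 1 at
        \<open>z\<close>.\<close>
      have T_eq: "T ?a (z, x0) = h (z, x0)"
        using Th[of ?a] a az Y_outside(2)[OF h]
          minus_bounded_functions[OF l_closed_Y[OF a h] r_closed_Y[OF a h]]
        by (simp add: l_def r_def)
      have D_eq: "D ?a (z, x0) = 1 / of_real (\<rho> z)"
        using z az by (simp add: D_def \<delta>_def)
      have Da: "D ?a \<in> carrier Y" by (rule D_closed_Y[OF a])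
      have "cmod (h (z, x0) - 1 / of_real (\<rho> z)) \<le> nrm Y (T ?a \<ominus>\<^bsub>Y\<^esub> D ?a)"
        using nrm_bounded_functions_ge[OF Y.M.minus_closed[OF Ta Da], of "(z, x0)"]
        unfolding minus_bounded_functions[OF Ta Da] T_eq D_eq .
      moreover have "cmod (1 / of_real (\<rho> z)) - cmod (h (z, x0)) \<le> cmod (h (z, x0) - 1 / of_real (\<rho> z))"
        by (metis norm_minus_commute norm_triangle_ineq2)
      moreover have "cmod (1 / of_real (\<rho> z)) = 1 / \<rho> z" by (simp add: norm_divide)
      ultimately show "1 / \<rho> z - nrm Y (T ?a \<ominus>\<^bsub>Y\<^esub> D ?a) \<le> M" using hz by linarith
    qed
    have "((\<lambda>T. 1 / \<rho> z - nrm Y (T ?a \<ominus>\<^bsub>Y\<^esub> D ?a)) \<longlongrightarrow> 1 / \<rho> z - 0) F"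
      by (intro tendsto_diff tendsto_const lim) (use a in simp)
    from tendsto_upperbound[OF this ev' F] show ?thesis by simp
  qed
  have "M \<ge> 0" by (simp add: M_def)
  \<comment> \<open>This choice forces \<open>M + 1 \<le> 1 / \<rho> z\<close>, against
    \<open>bound\<close>.\<close>
  then obtain z where z: "z \<in> X" "z \<noteq> x0" "\<rho> z \<le> 1 / (M + 1)"
    using exists_near_x0[of "1 / (M + 1)"] by auto
  then have "M + 1 \<le> 1 / \<rho> z" using \<open>M \<ge> 0\<close> by (simp add: field_simps)
  then show False using bound[OF z(1,2)] by simp
qed

end

theorem corollary3p8:
  fixes X :: "'x::metric_space set" and \<alpha> :: real
  assumes "compact X" and "infinite X" and "0 < \<alpha>" and "\<alpha> \<le> 1/2"
  shows "\<not> boundedly_approximately_contractible (lip_algebra \<alpha> X)"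
proof
  assume "boundedly_approximately_contractible (lip_algebra \<alpha> X)"
  \<comment> \<open>The bimodule \<open>Y\<close> lives on this type, so the property is transferred
    to it.\<close>
  then have univ: "boundedly_approximately_contractible_on TYPE('x \<times> 'x \<Rightarrow> complex) (lip_algebra \<alpha> X)"
    by (rule boundedly_approximately_contractible_universal)
  obtain x0 where "x0 \<in> X" "x0 islimpt X"
    using assms(1,2) unfolding compact_eq_Bolzano_Weierstrass by blast
  then interpret little_lipschitz_point X \<alpha> x0
    using assms by unfold_locales
  show False
    using univ bimodule_Y derivation_D not_boundedly_approximately_inner_D assms(4)
    unfolding boundedly_approximately_contractible_on_def by auto
qed

end
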